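(* Let $k$ be a positive integer. If a graph $G$ does not have $k+1$ pairwise vertex-disjoint cycles, then $G$ has a $k$-redundant blocker of size at most $f(k)+k$.
   Context: Graphs are finite and simple. A set $B$ of vertices of a graph $G$ is a blocker if the graph $G-B$ obtained by deleting the vertices in $B$ has no cycles. A blocker $B$ in $G$ is $k$-redundant if $B\setminus\{v\}$ is still a blocker for all but at most $k$ vertices $v\in B$. By the Erdős–Pósa theorem, for each positive integer $k$ there is a positive integer $m$ such that each graph which does not have $k+1$ pairwise vertex-disjoint cycles has a blocker of size at most $m$; $f(k)$ denotes the least such integer $m$. *)

theory Defs
  imports Main
begin

text \<open>A graph is a pair of a vertex set and a set of edges, an edge being a two-element set
  of vertices.\<close>

type_synonym 'a ugraph = "'a set \<times> 'a set set"

abbreviation ug_verts :: "'a ugraph \<Rightarrow> 'a set" where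
  "ug_verts G \<equiv> fst G"

abbreviation ug_edges :: "'a ugraph \<Rightarrow> 'a set set" where
  "ug_edges G \<equiv> snd G"

definition finite_simple_graph :: "'a ugraph \<Rightarrow> bool" where
  "finite_simple_graph G \<longleftrightarrow>
     finite (ug_verts G) \<and> (\<forall>e\<in>ug_edges G. e \<subseteq> ug_verts G \<and> card e = 2)"

definition delete_verts :: "'a ugraph \<Rightarrow> 'a set \<Rightarrow> 'a ugraph" where
  "delete_verts G B = (ug_verts G - B, {e \<in> ug_edges G. e \<inter> B = {}})"

text \<open>A cycle is given by the list of its vertices in cyclic order, the first vertex not being
  repeated at the end.\<close>

definition ug_cycle :: "'a ugraph \<Rightarrow> 'a list \<Rightarrow> bool" where
  "ug_cycle G c \<longleftrightarrow>
     3 \<le> length c \<and> distinct c \<and> set c \<subseteq> ug_verts G \<and>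
     (\<forall>i<length c. {c ! i, c ! (Suc i mod length c)} \<in> ug_edges G)"

definition has_disjoint_cycles :: "nat \<Rightarrow> 'a ugraph \<Rightarrow> bool" where
  "has_disjoint_cycles n G \<longleftrightarrow>
     (\<exists>C :: nat \<Rightarrow> 'a list. (\<forall>i<n. ug_cycle G (C i)) \<and>
        (\<forall>i<n. \<forall>j<n. i \<noteq> j \<longrightarrow> set (C i) \<inter> set (C j) = {}))"

definition blocker :: "'a ugraph \<Rightarrow> 'a set \<Rightarrow> bool" where
  "blocker G B \<longleftrightarrow> B \<subseteq> ug_verts G \<and> \<not> (\<exists>c. ug_cycle (delete_verts G B) c)"

definition redundant_blocker :: "nat \<Rightarrow> 'a ugraph \<Rightarrow> 'a set \<Rightarrow> bool" where
  "redundant_blocker k G B \<longleftrightarrow>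
     blocker G B \<and> card {v \<in> B. \<not> blocker G (B - {v})} \<le> k"

text \<open>The function \<open>f\<close> of the Erdos--Posa theorem. It ranges over all finite graphs;
  since each of these is isomorphic to one whose vertices are natural numbers, it is enough to
  quantify over graphs on type \<^typ>\<open>nat\<close>. That a suitable \<open>m\<close> exists, so that
  the least one is meaningful, is the content of the Erdos--Posa theorem.\<close>

definition erdos_posa_bound :: "nat \<Rightarrow> nat \<Rightarrow> bool" where
  "erdos_posa_bound k m \<longleftrightarrow>
     (\<forall>G :: nat ugraph. finite_simple_graph G \<longrightarrow> \<not> has_disjoint_cycles (k + 1) G \<longrightarrow>
        (\<exists>B. blocker G B \<and> card B \<le> m))"

definition erdos_posa_f :: "nat \<Rightarrow> nat" where
  "erdos_posa_f k = (LEAST m. 0 < m \<and> erdos_posa_bound k m)"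

end

theory Submission
  imports Defs
begin

text \<open>
  Deleting a blocker \<open>B\<close> with \<open>card B \<le> f(k)\<close> leaves a forest. Root it and take a lowest subtree
  that closes a cycle with some \<open>v \<in> B\<close>. By minimality every path of the forest which meets that
  subtree and closes a cycle with some other vertex of \<open>B\<close> passes through its root \<open>t\<close>. Put \<open>t\<close> into
  \<open>S\<close>, set \<open>v\<close> aside, delete the subtree and repeat. Each round produces a further disjoint cycle,
  so there are at most \<open>k\<close> rounds, and in \<open>B \<union> S\<close> only the vertices set aside can be irredundant.

  The least element defining \<open>f(k)\<close> is meaningful only because of the Erdos--Posa theorem. By
  deleting vertices of degree at most one and suppressing those of degree two, it reduces to
  graphs of minimum degree three, where it suffices to find a cycle of bounded length. Contracting
  stars repeatedly either meets a short cycle or raises the edge density until it forces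
  \<open>k + 1\<close> disjoint cycles.

  Cycles are handled by counting: a set of vertices contains a cycle if and only if some nonempty
  finite subset induces at least as many edges as it has vertices.
\<close>


section \<open>Edge counts and sets of vertices that contain a cycle\<close>

definition two_uniform :: "'a set set \<Rightarrow> bool" where
  "two_uniform E \<longleftrightarrow> (\<forall>e\<in>E. card e = 2)"

definition edges_in :: "'a set set \<Rightarrow> 'a set \<Rightarrow> 'a set set" where
  "edges_in E Y = {e \<in> E. e \<subseteq> Y}"

definition edges_at :: "'a set set \<Rightarrow> 'a set \<Rightarrow> 'a \<Rightarrow> 'a set set" where
  "edges_at E Y v = {e \<in> edges_in E Y. v \<in> e}"

text \<open>Nonemptiness matters: the empty set would satisfy the inequality trivially.\<close>

definition dense :: "'a set set \<Rightarrow> 'a set \<Rightarrow> bool" where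
  "dense E Y \<longleftrightarrow> finite Y \<and> Y \<noteq> {} \<and> card Y \<le> card (edges_in E Y)"

text \<open>Adding isolated vertices can destroy density, so it is the passage to a subset that
  makes this property monotone in \<open>X\<close>.\<close>

definition cyclic :: "'a set set \<Rightarrow> 'a set \<Rightarrow> bool" where
  "cyclic E X \<longleftrightarrow> (\<exists>Y\<subseteq>X. dense E Y)"

lemma finite_edges_in [simp]: "finite Y \<Longrightarrow> finite (edges_in E Y)"
  by (rule finite_subset[of _ "Pow Y"]) (auto simp: edges_in_def)

lemma finite_edges_at [simp]: "finite Y \<Longrightarrow> finite (edges_at E Y v)"
  by (simp add: edges_at_def)

lemma two_uniformD:
  assumes "two_uniform E" "e \<in> E" "v \<in> e"
  obtains w where "w \<noteq> v" "e = {v, w}"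
proof -
  from assms have "card e = 2" by (simp add: two_uniform_def)
  then obtain a b where "e = {a, b}" "a \<noteq> b" by (auto simp: card_2_iff)
  with assms(3) that[of b] that[of a] show thesis by auto
qed

lemma two_uniform_ne: "two_uniform E \<Longrightarrow> {v, w} \<in> E \<Longrightarrow> v \<noteq> w"
  by (auto simp: two_uniform_def)

lemma edges_in_empty: "two_uniform E \<Longrightarrow> edges_in E {} = {}"
  by (force simp: edges_in_def two_uniform_def)

lemma edges_in_singleton: "two_uniform E \<Longrightarrow> edges_in E {v} = {}"
  by (auto simp: two_uniform_def edges_in_def subset_singleton_iff)

lemma card_edges_in_remove:
  assumes "finite Y"
  shows "card (edges_in E Y) = card (edges_in E (Y - {v})) + card (edges_at E Y v)"
proof -
  have "edges_in E Y = edges_in E (Y - {v}) \<union> edges_at E Y v"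
    by (auto simp: edges_in_def edges_at_def)
  moreover have "edges_in E (Y - {v}) \<inter> edges_at E Y v = {}"
    by (auto simp: edges_in_def edges_at_def)
  ultimately show ?thesis using assms by (simp add: card_Un_disjoint)
qed

lemma card_edges_at:
  assumes "two_uniform E" "v \<in> Y"
  shows "card (edges_at E Y v) = card {w \<in> Y. {v, w} \<in> E}"
proof -
  have "bij_betw (\<lambda>w. {v, w}) {w \<in> Y. {v, w} \<in> E} (edges_at E Y v)"
    unfolding bij_betw_def
  proof
    show "inj_on (\<lambda>w. {v, w}) {w \<in> Y. {v, w} \<in> E}"
      by (auto simp: inj_on_def doubleton_eq_iff)
    show "(\<lambda>w. {v, w}) ` {w \<in> Y. {v, w} \<in> E} = edges_at E Y v"
    proof
      show "edges_at E Y v \<subseteq> (\<lambda>w. {v, w}) ` {w \<in> Y. {v, w} \<in> E}"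
      proof
        fix e assume e: "e \<in> edges_at E Y v"
        then obtain w where "e = {v, w}"
          using assms(1) by (auto simp: edges_at_def edges_in_def elim: two_uniformD)
        with e show "e \<in> (\<lambda>w. {v, w}) ` {w \<in> Y. {v, w} \<in> E}"
          by (auto simp: edges_at_def edges_in_def)
      qed
    qed (use assms(2) in \<open>auto simp: edges_at_def edges_in_def\<close>)
  qed
  then show ?thesis by (simp add: bij_betw_same_card)
qed

text \<open>Double counting of incidences: each edge inside \<open>V\<close> has exactly two
  ends.\<close>

lemma sum_card_edges_at:
  assumes "two_uniform E" "finite V"
  shows "(\<Sum>v\<in>V. card (edges_at E V v)) = 2 * card (edges_in E V)"
proof -
  have "(\<Sum>v\<in>V. card (edges_at E V v)) = (\<Sum>v\<in>V. \<Sum>e | e \<in> edges_in E V \<and> v \<in> e. 1)"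
    by (simp add: edges_at_def)
  also have "\<dots> = (\<Sum>e\<in>edges_in E V. \<Sum>v | v \<in> V \<and> v \<in> e. 1)"
    using assms(2) by (intro sum.swap_restrict) auto
  also have "\<dots> = (\<Sum>e\<in>edges_in E V. 2)"
  proof (rule sum.cong)
    fix e assume "e \<in> edges_in E V"
    then have "{v. v \<in> V \<and> v \<in> e} = e" "card e = 2"
      using assms(1) by (auto simp: edges_in_def two_uniform_def)
    then show "(\<Sum>v | v \<in> V \<and> v \<in> e. 1) = (2::nat)" by simp
  qed simp
  finally show ?thesis by simp
qed

lemma edges_in_mono: "E \<subseteq> E' \<Longrightarrow> Y \<subseteq> Y' \<Longrightarrow> edges_in E Y \<subseteq> edges_in E' Y'"
  by (auto simp: edges_in_def)

lemma cyclic_mono: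
  assumes "cyclic E X" "X \<subseteq> X'"
  shows "cyclic E X'"
  using assms unfolding cyclic_def by blast

lemma dense_cyclic: "dense E Y \<Longrightarrow> cyclic E Y"
  by (auto simp: cyclic_def)

lemma dense_not_singleton: "two_uniform E \<Longrightarrow> \<not> dense E {v}"
  by (simp add: dense_def edges_in_singleton)

lemma not_cyclic_card:
  assumes "\<not> cyclic E X" "Y \<subseteq> X" "finite Y" "Y \<noteq> {}"
  shows "card (edges_in E Y) < card Y"
  using assms by (auto simp: cyclic_def dense_def not_le)

text \<open>One vertex and at most one edge are lost, so the inequality survives. Something is left
  because a single vertex induces no edge.\<close>

lemma dense_remove:
  assumes "two_uniform E" "dense E Y" "card (edges_at E Y v) \<le> 1" "v \<in> Y"
  shows "dense E (Y - {v})"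
proof -
  have "Y \<noteq> {v}" using assms dense_not_singleton by metis
  then have "Y - {v} \<noteq> {}" using assms by blast
  moreover have "card (Y - {v}) = card Y - 1" using assms by (simp add: dense_def)
  moreover have "card (edges_in E Y) \<le> card (edges_in E (Y - {v})) + 1"
    using card_edges_in_remove[of Y E v] assms by (simp add: dense_def)
  ultimately show ?thesis using assms by (auto simp: dense_def)
qed

text \<open>A dense set of minimum size takes the place of a shortest cycle in the arguments
  below.\<close>

lemma obtain_dense_min:
  assumes "cyclic E X"
  obtains Y where "Y \<subseteq> X" "dense E Y" "\<And>Z. Z \<subseteq> X \<Longrightarrow> dense E Z \<Longrightarrow> card Y \<le> card Z"
proof -
  obtain Y where "Y \<subseteq> X \<and> dense E Y" using assms by (auto simp: cyclic_def)
  from ex_has_least_nat[of "\<lambda>Z. Z \<subseteq> X \<and> dense E Z", OF this, of card]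
  show thesis using that by blast
qed

subsection \<open>Cycles as lists\<close>

definition path :: "'a set set \<Rightarrow> 'a list \<Rightarrow> bool" where
  "path E p \<longleftrightarrow> distinct p \<and> successively (\<lambda>x y. {x, y} \<in> E) p"

text \<open>This is \<open>ug_cycle\<close> without the vertex set, so that a single edge set serves
  for all vertex-deleted subgraphs.\<close>

definition list_cycle :: "'a set set \<Rightarrow> 'a list \<Rightarrow> bool" where
  "list_cycle E c \<longleftrightarrow> 3 \<le> length c \<and> distinct c \<and>
     (\<forall>i<length c. {c ! i, c ! (Suc i mod length c)} \<in> E)"

text \<open>In the induction the edge from the new first vertex to the old one is new, since the new
  vertex does not lie on the rest of the path.\<close>

lemma path_card_edges:
  assumes "path E p" "p \<noteq> []"
  shows "length p \<le> Suc (card (edges_in E (set p)))"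
  using assms
proof (induction p)
  case (Cons x p)
  show ?case
  proof (cases "p = []")
    case False
    with Cons.prems have p: "path E p" "{x, hd p} \<in> E" "x \<notin> set p"
      by (auto simp: path_def successively_Cons)
    have "insert {x, hd p} (edges_in E (set p)) \<subseteq> edges_in E (set (x # p))"
      using p(2) False by (auto simp: edges_in_def)
    then have "card (insert {x, hd p} (edges_in E (set p))) \<le> card (edges_in E (set (x # p)))"
      by (intro card_mono) auto
    moreover have "{x, hd p} \<notin> edges_in E (set p)" using p(3) by (auto simp: edges_in_def)
    ultimately show ?thesis using Cons.IH[OF p(1) False] by simp
  qed simp
qed simp

text \<open>The assumption on \<open>P\<close> allows one edge fewer than vertices, as in a tree.
  The vertex \<open>w\<close> brings two new edges, which makes up for itself and for that
  deficit.\<close>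

lemma dense_insert:
  assumes "finite P" "w \<notin> P" "card P \<le> Suc (card (edges_in E P))"
    and "x \<in> P" "y \<in> P" "x \<noteq> y" "{w, x} \<in> E" "{w, y} \<in> E"
  shows "dense E (insert w P)"
proof -
  have "{w, x} \<noteq> {w, y}" using assms by (auto simp: doubleton_eq_iff)
  moreover have "{w, x} \<notin> edges_in E P" "{w, y} \<notin> edges_in E P"
    using assms by (auto simp: edges_in_def)
  ultimately have "card (insert {w, x} (insert {w, y} (edges_in E P))) = card (edges_in E P) + 2"
    using assms(1) by simp
  moreover have "insert {w, x} (insert {w, y} (edges_in E P)) \<subseteq> edges_in E (insert w P)"
    using assms by (auto simp: edges_in_def)
  then have "card (insert {w, x} (insert {w, y} (edges_in E P))) \<le> card (edges_in E (insert w P))"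
    using assms(1) by (intro card_mono) auto
  ultimately show ?thesis using assms by (auto simp: dense_def)
qed

lemma list_cycle_rotate:
  assumes "list_cycle E c"
  shows "list_cycle E (rotate m c)"
  unfolding list_cycle_def
proof (intro conjI allI impI)
  fix i assume i: "i < length (rotate m c)"
  let ?n = "length c"
  have n: "0 < ?n" "i < ?n" using assms i by (auto simp: list_cycle_def)
  have "rotate m c ! i = c ! ((m + i) mod ?n)" using n by (simp add: nth_rotate)
  moreover have "rotate m c ! (Suc i mod ?n) = c ! (Suc ((m + i) mod ?n) mod ?n)"
    using n by (simp add: nth_rotate mod_simps)
  moreover have "(m + i) mod ?n < ?n" using n by simp
  ultimately show "{rotate m c ! i, rotate m c ! (Suc i mod length (rotate m c))} \<in> E"
    using assms unfolding list_cycle_def by simp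
qed (use assms in \<open>auto simp: list_cycle_def\<close>)

text \<open>Cutting a cycle at its first vertex leaves a path whose ends are the two neighbours of
  that vertex on the cycle.\<close>

lemma list_cycle_ConsD:
  assumes "list_cycle E (w # p)"
  shows "path E p" "w \<notin> set p" "2 \<le> length p" "{w, hd p} \<in> E" "{w, last p} \<in> E"
    and "hd p \<noteq> last p" "p \<noteq> []"
proof -
  have d: "distinct (w # p)" "2 \<le> length p" using assms by (auto simp: list_cycle_def)
  then show "w \<notin> set p" "2 \<le> length p" "p \<noteq> []" by auto
  have e: "{(w # p) ! i, (w # p) ! (Suc i mod Suc (length p))} \<in> E" if "i \<le> length p" for i
    using assms that by (auto simp: list_cycle_def)
  have "{p ! i, p ! Suc i} \<in> E" if "Suc i < length p" for i
    using e[of "Suc i"] that by (simp add: mod_less)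
  then show "path E p" using d by (simp add: path_def successively_conv_nth)
  show "{w, hd p} \<in> E" using e[of 0] d by (cases p) auto
  show "{w, last p} \<in> E" using e[of "length p"] d
    by (cases p) (auto simp: last_conv_nth insert_commute nth_Cons')
  show "hd p \<noteq> last p" using d
    by (cases p) auto
qed

lemma path_closed_dense:
  assumes "path E p" "w \<notin> set p" "2 \<le> length p" "{w, hd p} \<in> E" "{w, last p} \<in> E"
  shows "dense E (insert w (set p))"
proof (rule dense_insert[where x = "hd p" and y = "last p"])
  have "p \<noteq> []" using assms by auto
  then show "hd p \<in> set p" "last p \<in> set p" by auto
  show "card (set p) \<le> Suc (card (edges_in E (set p)))"
    using path_card_edges[OF assms(1) \<open>p \<noteq> []\<close>] assms by (simp add: path_def distinct_card)
  show "hd p \<noteq> last p" using assms by (cases p) (auto simp: path_def)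
qed (use assms in auto)

lemma list_cycle_dense:
  assumes "list_cycle E c"
  shows "dense E (set c)"
proof -
  obtain w p where c: "c = w # p" using assms by (cases c) (auto simp: list_cycle_def)
  show ?thesis using path_closed_dense[of E p w] list_cycle_ConsD assms c by fastforce
qed

text \<open>A longest path in a graph of minimum degree at least two closes up at its first vertex.\<close>

lemma min_degree_list_cycle:
  assumes "two_uniform E" "finite Y" "Y \<noteq> {}" "\<And>v. v \<in> Y \<Longrightarrow> 2 \<le> card (edges_at E Y v)"
  obtains c where "list_cycle E c" "set c \<subseteq> Y"
proof -
  let ?P = "\<lambda>p. path E p \<and> set p \<subseteq> Y \<and> p \<noteq> []"
  obtain y where "y \<in> Y" using assms by auto
  then have "?P [y]" by (simp add: path_def)
  moreover have "\<forall>p. ?P p \<longrightarrow> length p < Suc (card Y)"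
    using assms(2) by (metis card_mono distinct_card less_Suc_eq_le path_def)
  ultimately obtain p where p: "?P p" and max: "\<And>q. ?P q \<Longrightarrow> length q \<le> length p"
    using ex_has_greatest_nat[of ?P "[y]" length "Suc (card Y)"] by blast
  define v where "v = hd p"
  have v: "v \<in> Y" "p ! 0 = v" using p by (auto simp: v_def hd_conv_nth)
  let ?N = "{w \<in> Y. {v, w} \<in> E}"
  have N: "2 \<le> card ?N" using assms v card_edges_at by metis
  have "?N \<subseteq> set p"
  proof
    fix w assume w: "w \<in> ?N"
    show "w \<in> set p"
    proof (rule ccontr)
      assume "w \<notin> set p"
      then have "?P (w # p)" using w p
        by (auto simp: path_def successively_Cons v_def insert_commute)
      with max[of "w # p"] show False by simp
    qed
  qed
  \<comment> \<open>Degree two gives a neighbour of \<open>v\<close> other than its successor on the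
    path. It sits at an index of at least two, so the prefix that it closes has at least three
    vertices.\<close>
  have "\<not> ?N \<subseteq> {p ! 1}"
  proof
    assume "?N \<subseteq> {p ! 1}"
    then have "card ?N \<le> 1" using card_mono[of "{p ! 1}"] by auto
    with N show False by simp
  qed
  then obtain w where w: "w \<in> ?N" "w \<noteq> p ! 1" by auto
  then obtain j where j: "j < length p" "w = p ! j"
    using \<open>?N \<subseteq> set p\<close> by (metis in_set_conv_nth subsetD)
  have "w \<noteq> v" using w two_uniform_ne[OF assms(1)] by blast
  then have "2 \<le> j" using j w v by (metis One_nat_def less_2_cases not_le)
  let ?c = "take (Suc j) p"
  have len: "length ?c = Suc j" using j by simp
  have "list_cycle E ?c"
    unfolding list_cycle_def
  proof (intro conjI allI impI)
    show "3 \<le> length ?c" using len \<open>2 \<le> j\<close> by simp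
    show "distinct ?c" using p by (simp add: path_def)
    fix i assume i: "i < length ?c"
    show "{?c ! i, ?c ! (Suc i mod length ?c)} \<in> E"
    proof (cases "i = j")
      case True
      then show ?thesis using w j v len by (simp add: insert_commute)
    next
      case False
      then have "i < j" using i len by simp
      then have "{p ! i, p ! Suc i} \<in> E"
        using p j by (simp add: path_def successively_conv_nth)
      then show ?thesis using \<open>i < j\<close> len by simp
    qed
  qed
  moreover have "set ?c \<subseteq> Y" using p set_take_subset[of "Suc j" p] by blast
  ultimately show thesis by (rule that)
qed

text \<open>A smallest dense set has minimum degree at least two, because by
  \<open>dense_remove\<close> a vertex of smaller degree could be removed.\<close>

lemma cyclic_list_cycle:
  assumes "two_uniform E" "cyclic E X"
  obtains c where "list_cycle E c" "set c \<subseteq> X"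
proof -
  obtain Y where Y: "Y \<subseteq> X" "dense E Y" and
    min: "\<And>Z. Z \<subseteq> X \<Longrightarrow> dense E Z \<Longrightarrow> card Y \<le> card Z"
    using obtain_dense_min[OF assms(2)] by blast
  have "2 \<le> card (edges_at E Y v)" if "v \<in> Y" for v
  proof (rule ccontr)
    assume "\<not> ?thesis"
    then have "dense E (Y - {v})" using dense_remove[OF assms(1) Y(2) _ that] by simp
    then have "card Y \<le> card (Y - {v})" using min Y by blast
    moreover have "card (Y - {v}) < card Y"
      using Y that by (intro psubset_card_mono) (auto simp: dense_def)
    ultimately show False by simp
  qed
  then obtain c where "list_cycle E c" "set c \<subseteq> Y"
    using min_degree_list_cycle[OF assms(1)] Y(2) unfolding dense_def by blast
  then show thesis using that Y(1) by blast
qed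


section \<open>Packings of disjoint cyclic sets\<close>

text \<open>The recursion lets proofs split off one set at a time. The sets need not be cycles; each
  of them contains one.\<close>

primrec packing :: "'a set set \<Rightarrow> nat \<Rightarrow> 'a set \<Rightarrow> bool" where
  "packing E 0 X \<longleftrightarrow> True"
| "packing E (Suc n) X \<longleftrightarrow> (\<exists>C\<subseteq>X. cyclic E C \<and> packing E n (X - C))"

lemma packing_mono: "packing E n X \<Longrightarrow> X \<subseteq> X' \<Longrightarrow> packing E n X'"
proof (induction n arbitrary: X X')
  case (Suc n)
  then obtain C where "C \<subseteq> X" "cyclic E C" "packing E n (X - C)" by auto
  moreover have "packing E n (X' - C)"
    using Suc.IH[OF \<open>packing E n (X - C)\<close>, of "X' - C"] Suc.prems by blast
  ultimately show ?case using Suc.prems by auto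
qed simp

lemma packing_SucI:
  assumes "cyclic E C" "C \<subseteq> X" "packing E n Y" "Y \<subseteq> X - C"
  shows "packing E (Suc n) X"
  using assms packing_mono[OF assms(3,4)] by auto

lemma edges_in_cong:
  "(\<And>e. e \<subseteq> X \<Longrightarrow> e \<in> E \<longleftrightarrow> e \<in> E') \<Longrightarrow> Y \<subseteq> X \<Longrightarrow> edges_in E Y = edges_in E' Y"
  by (auto simp: edges_in_def)

lemma cyclic_cong:
  assumes "\<And>e. e \<subseteq> X \<Longrightarrow> e \<in> E \<longleftrightarrow> e \<in> E'"
  shows "cyclic E X \<longleftrightarrow> cyclic E' X"
  unfolding cyclic_def dense_def using edges_in_cong[of X E E', OF assms] by auto

text \<open>Only edges inside \<open>X\<close> matter. This serves to discard an added edge once its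
  ends have been removed.\<close>

lemma packing_cong:
  "(\<And>e. e \<subseteq> X \<Longrightarrow> e \<in> E \<longleftrightarrow> e \<in> E') \<Longrightarrow> packing E n X \<longleftrightarrow> packing E' n X"
proof (induction n arbitrary: X)
  case (Suc n)
  have "cyclic E C \<longleftrightarrow> cyclic E' C" "packing E n (X - C) \<longleftrightarrow> packing E' n (X - C)" if "C \<subseteq> X" for C
  proof -
    show "cyclic E C \<longleftrightarrow> cyclic E' C"
      by (rule cyclic_cong) (use Suc.prems that in blast)
    show "packing E n (X - C) \<longleftrightarrow> packing E' n (X - C)"
      by (rule Suc.IH) (use Suc.prems in blast)
  qed
  then show ?case by auto
qed simp

subsection \<open>Many edges force many disjoint cycles\<close>

text \<open>By minimality the set left after removing a vertex \<open>v\<close> has fewer edges than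
  vertices, and \<open>v\<close> itself meets at most \<open>card C\<close> edges.\<close>

lemma min_dense_card_le:
  assumes E: "two_uniform E" and V: "finite V" "C \<subseteq> V" "dense E C"
    and min: "\<And>Z. Z \<subseteq> V \<Longrightarrow> dense E Z \<Longrightarrow> card C \<le> card Z"
  shows "card (edges_in E C) \<le> 2 * card C"
proof -
  obtain v where v: "v \<in> C" using V by (auto simp: dense_def)
  have fin: "finite C" using V by (auto simp: dense_def)
  have lt: "card (C - {v}) < card C" using fin v by (intro psubset_card_mono) auto
  have "\<not> dense E (C - {v})"
  proof
    assume "dense E (C - {v})"
    then have "card C \<le> card (C - {v})" using min V by blast
    with lt show False by simp
  qed
  moreover have "C - {v} \<noteq> {}" using v dense_not_singleton[OF E] V(3) by (metis insert_Diff)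
  ultimately have "card (edges_in E (C - {v})) < card (C - {v})"
    using fin by (auto simp: dense_def not_le)
  moreover have "card (edges_at E C v) \<le> card C"
    using card_edges_at[OF E v] fin by (simp add: card_mono)
  ultimately show ?thesis using card_edges_in_remove[OF fin, of E v] lt by linarith
qed

text \<open>Among four neighbours on a shortest cycle, the first two enclose an arc that misses two
  vertices of the cycle, so that closing it through the outer vertex gives a shorter cycle.\<close>

lemma min_dense_card_neighbours_le:
  assumes E: "two_uniform E" and V: "finite V" "C \<subseteq> V" "dense E C"
    and min: "\<And>Z. Z \<subseteq> V \<Longrightarrow> dense E Z \<Longrightarrow> card C \<le> card Z"
    and w: "w \<in> V - C"
  shows "card {x \<in> C. {w, x} \<in> E} \<le> 3"
proof (rule ccontr)
  assume 4: "\<not> ?thesis"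
  have fin: "finite C" using V by (auto simp: dense_def)
  obtain c where c: "list_cycle E c" "set c \<subseteq> C"
    using cyclic_list_cycle[OF E dense_cyclic[OF V(3)]] by blast
  \<comment> \<open>The cycle is itself dense, so minimality forces it to use every vertex of
    \<open>C\<close>.\<close>
  then have "card C \<le> card (set c)" using min list_cycle_dense V by blast
  then have C: "set c = C" using c(2) fin by (simp add: card_seteq)
  let ?n = "length c"
  have n: "card C = ?n" "distinct c" using c C by (auto simp: list_cycle_def distinct_card)
  define P where "P = {i. i < ?n \<and> {w, c ! i} \<in> E}"
  have finP: "finite P" by (simp add: P_def)
  have "{x \<in> C. {w, x} \<in> E} = (!) c ` P" using C by (auto simp: P_def in_set_conv_nth)
  then have "4 \<le> card P" using 4 card_image_le[OF finP, of "(!) c"] by simp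
  define i where "i = Min P"
  have i: "i \<in> P" "\<And>t. t \<in> P \<Longrightarrow> i \<le> t"
    using finP \<open>4 \<le> card P\<close> by (auto simp: i_def intro!: Min_in)
  define j where "j = Min (P - {i})"
  have c1: "3 \<le> card (P - {i})" using \<open>4 \<le> card P\<close> finP i by (simp add: card_Diff_singleton)
  then have ne: "P - {i} \<noteq> {}" by (metis card.empty not_numeral_le_zero)
  have j: "j \<in> P - {i}" using Min_in[of "P - {i}"] ne finP by (simp add: j_def)
  have jmin: "j \<le> t" if "t \<in> P - {i}" for t using that finP by (auto simp: j_def)
  have ij: "i < j" using i j by force
  have "P - {i} - {j} \<subseteq> {Suc j..<?n}"
  proof
    fix t assume t: "t \<in> P - {i} - {j}"
    then have "j \<le> t" using jmin by blast
    with t show "t \<in> {Suc j..<?n}" by (auto simp: P_def)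
  qed
  then have "card (P - {i} - {j}) \<le> ?n - Suc j"
    using card_mono[OF finite_atLeastLessThan, of "P - {i} - {j}" "Suc j" ?n] by simp
  moreover have "2 \<le> card (P - {i} - {j})" using c1 j finP by (simp add: card_Diff_singleton)
  \<comment> \<open>Two neighbours of \<open>w\<close> have an index above \<open>j\<close>, so the
    arc from \<open>i\<close> to \<open>j\<close> has at most \<open>?n - 2\<close> vertices and is
    still shorter than the cycle when \<open>w\<close> is added.\<close>
  ultimately have jn: "j + 3 \<le> ?n" by linarith
  define p where "p = drop i (take (Suc j) c)"
  have lenp: "length p = Suc j - i" using jn by (simp add: p_def)
  have nth: "p ! t = c ! (i + t)" if "t < length p" for t
    using that jn lenp by (simp add: p_def)
  have "path E p"
    unfolding path_def successively_conv_nth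
  proof (intro conjI allI impI)
    show "distinct p" using n by (simp add: p_def)
    fix t assume t: "Suc t < length p"
    then have "Suc (i + t) < ?n" using lenp jn by simp
    then have "{c ! (i + t), c ! Suc (i + t)} \<in> E"
      using c(1) unfolding list_cycle_def by (metis Suc_lessD mod_less)
    then show "{p ! t, p ! Suc t} \<in> E" using t nth by simp
  qed
  moreover have sub: "set p \<subseteq> C"
    unfolding p_def using C by (meson order_trans set_drop_subset set_take_subset)
  moreover have "2 \<le> length p" using lenp ij by simp
  moreover have "p \<noteq> []" using lenp ij by auto
  then have "hd p = c ! i" "last p = c ! j"
    using nth lenp ij by (simp_all add: hd_conv_nth last_conv_nth)
  then have "{w, hd p} \<in> E" "{w, last p} \<in> E" using i j by (auto simp: P_def)
  ultimately have "dense E (insert w (set p))" using path_closed_dense[of E p w] w by blast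
  moreover have "insert w (set p) \<subseteq> V" using sub w V by blast
  ultimately have "card C \<le> card (insert w (set p))" by (intro min)
  also have "\<dots> \<le> Suc (length p)" using card_length[of p] by (simp add: card_insert_if)
  also have "\<dots> < card C" using lenp jn n by simp
  finally show False by simp
qed

text \<open>An edge inside \<open>V\<close> avoids \<open>C\<close>, lies in \<open>C\<close>, or
  joins a vertex outside to one inside; edges of the third kind are counted at their outer
  end.\<close>

lemma card_edges_in_Diff_le:
  assumes E: "two_uniform E" and V: "finite V" "C \<subseteq> V"
    and nb: "\<And>w. w \<in> V - C \<Longrightarrow> card {x \<in> C. {w, x} \<in> E} \<le> d"
  shows "card (edges_in E V) \<le> card (edges_in E (V - C)) + card (edges_in E C) + d * card (V - C)"
proof -
  let ?N = "\<lambda>w. (\<lambda>x. {w, x}) ` {x \<in> C. {w, x} \<in> E}"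
  have fin: "finite C" using V by (rule rev_finite_subset)
  have "edges_in E V \<subseteq> edges_in E (V - C) \<union> edges_in E C \<union> (\<Union>w\<in>V - C. ?N w)"
  proof
    fix e assume e: "e \<in> edges_in E V"
    then have eE: "e \<in> E" "e \<subseteq> V" by (auto simp: edges_in_def)
    show "e \<in> edges_in E (V - C) \<union> edges_in E C \<union> (\<Union>w\<in>V - C. ?N w)"
    proof (cases "e \<subseteq> C")
      case False
      then obtain w where w: "w \<in> e" "w \<notin> C" by auto
      obtain x where "e = {w, x}" using two_uniformD[OF E eE(1) w(1)] by blast
      then show ?thesis using eE w by (cases "x \<in> C") (auto simp: edges_in_def)
    qed (use eE in \<open>auto simp: edges_in_def\<close>)
  qed
  then have "card (edges_in E V) \<le> card (edges_in E (V - C) \<union> edges_in E C \<union> (\<Union>w\<in>V - C. ?N w))"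
    using V fin by (intro card_mono) auto
  also have "\<dots> \<le> card (edges_in E (V - C)) + card (edges_in E C) + card (\<Union>w\<in>V - C. ?N w)"
    using card_Un_le[of "edges_in E (V - C) \<union> edges_in E C"]
      card_Un_le[of "edges_in E (V - C)" "edges_in E C"] by (meson add_le_mono1 le_trans)
  also have "card (\<Union>w\<in>V - C. ?N w) \<le> (\<Sum>w\<in>V - C. card (?N w))"
    using V by (intro card_UN_le) auto
  also have "\<dots> \<le> (\<Sum>w\<in>V - C. d)"
  proof (rule sum_mono)
    fix w assume w: "w \<in> V - C"
    have "card (?N w) \<le> card {x \<in> C. {w, x} \<in> E}" using fin by (intro card_image_le) simp
    with nb[OF w] show "card (?N w) \<le> d" by simp
  qed
  finally show ?thesis by (simp add: mult.commute)
qed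

text \<open>Removing a smallest dense set \<open>C\<close> destroys at most
  \<open>2 * card C + 3 * card (V - C)\<close> edges, hence at most \<open>3 * card V\<close>. This
  is the difference between the bounds for \<open>Suc n\<close> and \<open>n\<close>.\<close>

lemma packing_if_many_edges:
  assumes "two_uniform E" "finite V" "V \<noteq> {}" "3 * n * card V \<le> card (edges_in E V)"
  shows "packing E n V"
  using assms(2-)
proof (induction n arbitrary: V)
  case (Suc n)
  have V: "0 < card V" using Suc.prems by (simp add: card_gt_0_iff)
  have many: "3 * n * card V + 3 * card V \<le> card (edges_in E V)"
    using Suc.prems(3) by (simp add: algebra_simps)
  then have "dense E V" using Suc.prems by (simp add: dense_def)
  then obtain C where C: "C \<subseteq> V" "dense E C" and
    min: "\<And>Z. Z \<subseteq> V \<Longrightarrow> dense E Z \<Longrightarrow> card C \<le> card Z"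
    using obtain_dense_min[OF dense_cyclic] by blast
  have EC: "card (edges_in E C) \<le> 2 * card C"
    using min_dense_card_le[OF assms(1) Suc.prems(1) C min] .
  \<comment> \<open>\<open>V\<close> has at least three edges per vertex but \<open>C\<close> at
    most two. So something is left for the induction hypothesis, which requires a nonempty
    set.\<close>
  have "C \<noteq> V" using EC many V by auto
  then have ne: "V - C \<noteq> {}" using C by auto
  have "card (edges_in E V) \<le> card (edges_in E (V - C)) + card (edges_in E C) + 3 * card (V - C)"
    using card_edges_in_Diff_le[OF assms(1) Suc.prems(1) C(1)]
      min_dense_card_neighbours_le[OF assms(1) Suc.prems(1) C min] by blast
  moreover have card: "card V = card (V - C) + card C"
    using C Suc.prems(1) by (metis add.commute card_Diff_subset card_mono finite_subset le_add_diff_inverse)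
  moreover have "3 * n * card V = 3 * n * card (V - C) + 3 * n * card C"
    unfolding card by (simp add: algebra_simps)
  ultimately have "3 * n * card (V - C) \<le> card (edges_in E (V - C))"
    using EC many by linarith
  then have "packing E n (V - C)" using Suc.IH Suc.prems(1) ne by simp
  then show ?case using C dense_cyclic by auto
qed simp


subsection \<open>Contracting stars\<close>

text \<open>The map sends each vertex to the centre of its star. The centre represents the
  contracted star, so the contracted graph lives on the same vertex type; by idempotence each star
  consists of its centre and leaves adjacent to it.\<close>

locale star_contraction =
  fixes E :: "'a set set" and Y :: "'a set" and \<phi> :: "'a \<Rightarrow> 'a"
  assumes two_uniform: "two_uniform E" and finite: "finite Y"
    and center_in: "v \<in> Y \<Longrightarrow> \<phi> v \<in> Y"
    and center_idem: "v \<in> Y \<Longrightarrow> \<phi> (\<phi> v) = \<phi> v"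
    and center_adj: "v \<in> Y \<Longrightarrow> \<phi> v \<noteq> v \<Longrightarrow> {v, \<phi> v} \<in> E"
begin

text \<open>An edge within a star is mapped to a single vertex; leaving it out prevents
  loops.\<close>

definition cross :: "'a set set" where
  "cross = {e \<in> edges_in E Y. card (\<phi> ` e) = 2}"

definition contracted :: "'a set set" where
  "contracted = (`) \<phi> ` cross"

lemma two_uniform_contracted: "two_uniform contracted"
  by (auto simp: two_uniform_def contracted_def cross_def)

lemma cross_subset: "cross \<subseteq> edges_in E Y"
  by (auto simp: cross_def)

lemma finite_cross: "Finite_Set.finite cross"
  using cross_subset finite finite_edges_in finite_subset by blast

text \<open>Adding the star edges at the leaves of the lifted edges costs one vertex per edge, so the
  excess of edges over vertices is that of \<open>F\<close> over \<open>W\<close>.\<close>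

lemma dense_lift_edges:
  assumes F: "F \<subseteq> cross" and W: "W \<subseteq> \<phi> ` Y" "W \<noteq> {}"
    and FW: "\<And>e. e \<in> F \<Longrightarrow> \<phi> ` e \<subseteq> W" and le: "card W \<le> card F"
  shows "dense E (W \<union> \<Union>F)" "card (W \<union> \<Union>F) \<le> card W + 2 * card F"
    and "W \<union> \<Union>F \<subseteq> {v \<in> Y. \<phi> v \<in> W}"
proof -
  let ?Z = "W \<union> \<Union>F"
  let ?star = "(\<lambda>v. {v, \<phi> v}) ` (?Z - W)"
  have finW: "Finite_Set.finite W" using W finite by (meson finite_imageI finite_subset)
  have finF: "Finite_Set.finite F" using F finite_cross by (rule finite_subset)
  have FE: "e \<subseteq> Y" "e \<in> E" "card (\<phi> ` e) = 2" if "e \<in> F" for e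
    using that F by (auto simp: cross_def edges_in_def)
  show Z: "?Z \<subseteq> {v \<in> Y. \<phi> v \<in> W}"
  proof
    fix v assume "v \<in> ?Z"
    then consider "v \<in> W" | e where "e \<in> F" "v \<in> e" by blast
    then show "v \<in> {v \<in> Y. \<phi> v \<in> W}"
    proof cases
      case 1
      then obtain u where "u \<in> Y" "v = \<phi> u" using W by blast
      then show ?thesis using 1 center_in[of u] center_idem[of u] by simp
    next
      case 2
      then show ?thesis using FE(1) FW by blast
    qed
  qed
  then have finZ: "Finite_Set.finite ?Z" using finite by (auto intro: finite_subset)
  \<comment> \<open>The two ends are told apart by \<open>W\<close>: the leaf lies outside, its
    centre inside.\<close>
  have "inj_on (\<lambda>v. {v, \<phi> v}) (?Z - W)"
    using Z by (auto simp: inj_on_def doubleton_eq_iff)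
  then have "card ?star = card (?Z - W)" by (rule card_image)
  moreover have "card (?Z - W) = card ?Z - card W" using finW by (intro card_Diff_subset) auto
  moreover have "card W \<le> card ?Z" using finZ by (intro card_mono) auto
  \<comment> \<open>Star edges collapse to one vertex under the contraction, whereas edges of
    \<open>F\<close> do not.\<close>
  moreover have "?star \<inter> F = {}"
  proof -
    have "{v, \<phi> v} \<notin> F" if "v \<in> ?Z" for v
    proof
      assume "{v, \<phi> v} \<in> F"
      then have "card (\<phi> ` {v, \<phi> v}) = 2" by (rule FE(3))
      moreover have "\<phi> (\<phi> v) = \<phi> v" using that Z center_idem by blast
      ultimately show False by simp
    qed
    then show ?thesis by blast
  qed
  then have "card (?star \<union> F) = card ?star + card F"
    using finF finZ by (intro card_Un_disjoint) auto
  moreover have "?star \<union> F \<subseteq> edges_in E ?Z"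
  proof -
    have "{v, \<phi> v} \<in> edges_in E ?Z" if "v \<in> ?Z - W" for v
    proof -
      have v: "v \<in> Y" "\<phi> v \<in> W" using that Z by blast+
      then have "\<phi> v \<noteq> v" using that by auto
      then have "{v, \<phi> v} \<in> E" using v center_adj by simp
      then show ?thesis using that v by (auto simp: edges_in_def)
    qed
    moreover have "F \<subseteq> edges_in E ?Z" using FE by (auto simp: edges_in_def)
    ultimately show ?thesis by blast
  qed
  then have "card (?star \<union> F) \<le> card (edges_in E ?Z)" using finZ by (intro card_mono) auto
  ultimately have "card ?Z \<le> card (edges_in E ?Z)" using le by linarith
  then show "dense E ?Z" using finZ W by (auto simp: dense_def)
  have "card (\<Union>F) \<le> (\<Sum>e\<in>F. card e)" by (rule card_Union_le_sum_card)
  also have "\<dots> = 2 * card F" using FE two_uniform by (simp add: two_uniform_def)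
  finally show "card ?Z \<le> card W + 2 * card F"
    using card_Un_le[of W "\<Union>F"] by linarith
qed

text \<open>One preimage is chosen for each of exactly \<open>card W\<close> contracted edges. Their
  ends together with \<open>W\<close> number at most \<open>card W + 2 * card W\<close>, whence the
  factor three.\<close>

lemma dense_lift:
  assumes "dense contracted W" "W \<subseteq> \<phi> ` Y"
  obtains Z where "dense E Z" "Z \<subseteq> {v \<in> Y. \<phi> v \<in> W}" "card Z \<le> 3 * card W"
proof -
  obtain F' where F': "F' \<subseteq> edges_in contracted W" "card F' = card W"
    using assms by (meson dense_def obtain_subset_with_card_n)
  then have "F' \<subseteq> (`) \<phi> ` cross" by (auto simp: edges_in_def contracted_def)
  then obtain F where F: "F \<subseteq> cross" "inj_on ((`) \<phi>) F" "F' = (`) \<phi> ` F"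
    using subset_image_inj by metis
  then have card: "card F = card W" using F' by (simp add: card_image)
  have "\<phi> ` e \<subseteq> W" if "e \<in> F" for e using that F F' by (auto simp: edges_in_def)
  note lift = dense_lift_edges[OF F(1) assms(2) _ this]
  show thesis
    by (rule that[of "W \<union> \<Union>F"]) (use lift assms card in \<open>auto simp: dense_def\<close>)
qed

lemma cyclic_lift:
  assumes "cyclic contracted X" "X \<subseteq> \<phi> ` Y"
  shows "cyclic E {v \<in> Y. \<phi> v \<in> X}"
proof -
  obtain W where W: "W \<subseteq> X" "dense contracted W" using assms by (auto simp: cyclic_def)
  obtain Z where "dense E Z" "Z \<subseteq> {v \<in> Y. \<phi> v \<in> W}"
    by (rule dense_lift[OF W(2)]) (use W(1) assms(2) in auto)
  then show ?thesis using W by (auto simp: cyclic_def)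
qed

text \<open>Disjoint sets of centres have disjoint preimages.\<close>

lemma packing_lift:
  "packing contracted n X \<Longrightarrow> X \<subseteq> \<phi> ` Y \<Longrightarrow> packing E n {v \<in> Y. \<phi> v \<in> X}"
proof (induction n arbitrary: X)
  case (Suc n)
  then obtain C where C: "C \<subseteq> X" "cyclic contracted C" "packing contracted n (X - C)" by auto
  have "packing E n {v \<in> Y. \<phi> v \<in> X - C}" using Suc.IH C(3) Suc.prems(2) by blast
  moreover have "cyclic E {v \<in> Y. \<phi> v \<in> C}" using cyclic_lift C Suc.prems(2) by blast
  ultimately show ?case
    using C(1) packing_SucI[of E "{v \<in> Y. \<phi> v \<in> C}" "{v \<in> Y. \<phi> v \<in> X}" n
        "{v \<in> Y. \<phi> v \<in> X - C}"] by blast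
qed simp

text \<open>Two crossing edges with the same image would lift to a dense set of at most
  \<open>2 + 2 * 2\<close> vertices, and an edge between two leaves of one star would close a
  triangle; \<open>short\<close> excludes both. So only star edges are lost, at most one for each
  vertex that is not a centre.\<close>

lemma card_edges_le_contracted:
  assumes short: "\<And>Z. Z \<subseteq> Y \<Longrightarrow> dense E Z \<Longrightarrow> 6 < card Z"
  shows "card (edges_in E Y) \<le> card (edges_in contracted (\<phi> ` Y)) + card (Y - \<phi> ` Y)"
proof -
  have inj: "inj_on ((`) \<phi>) cross"
  proof (rule inj_onI, rule ccontr)
    fix e e' assume e: "e \<in> cross" "e' \<in> cross" "\<phi> ` e = \<phi> ` e'" "e \<noteq> e'"
    let ?F = "{e, e'}" and ?W = "\<phi> ` e"
    have "card ?W = 2" "e \<subseteq> Y" using e(1) by (auto simp: cross_def edges_in_def)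
    moreover from this have "?W \<subseteq> \<phi> ` Y" "?W \<noteq> {}" by auto
    moreover have "card ?F = 2" "?F \<subseteq> cross" using e by auto
    moreover have "\<phi> ` d \<subseteq> ?W" if "d \<in> ?F" for d using that e(3) by auto
    ultimately have "dense E (?W \<union> \<Union>?F)" "card (?W \<union> \<Union>?F) \<le> 6" "?W \<union> \<Union>?F \<subseteq> Y"
      using dense_lift_edges[of ?F ?W] by auto
    then show False using short[of "?W \<union> \<Union>?F"] by simp
  qed
  have "edges_in contracted (\<phi> ` Y) = contracted"
    by (auto simp: edges_in_def contracted_def cross_def)
  then have card_cross: "card (edges_in contracted (\<phi> ` Y)) = card cross"
    using inj by (simp add: contracted_def card_image)
  have "edges_in E Y - cross \<subseteq> (\<lambda>v. {v, \<phi> v}) ` (Y - \<phi> ` Y)"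
  proof
    fix e assume e: "e \<in> edges_in E Y - cross"
    then have "e \<in> E" "e \<subseteq> Y" by (auto simp: edges_in_def)
    then obtain u v where uv: "e = {u, v}" "u \<noteq> v"
      using two_uniform by (auto simp: two_uniform_def card_2_iff)
    then have Y: "u \<in> Y" "v \<in> Y" "{u, v} \<in> E" using \<open>e \<in> E\<close> \<open>e \<subseteq> Y\<close> by auto
    have same: "\<phi> u = \<phi> v" using e uv by (auto simp: cross_def card_insert_if split: if_splits)
    consider "\<phi> u = u" | "\<phi> u = v" | "\<phi> u \<noteq> u" "\<phi> v \<noteq> v" using same by metis
    then show "e \<in> (\<lambda>v. {v, \<phi> v}) ` (Y - \<phi> ` Y)"
    proof cases
      case 1
      then have "\<phi> v \<noteq> v" using same uv by simp
      then have "v \<notin> \<phi> ` Y" using center_idem by blast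
      moreover have "e = {v, \<phi> v}" using 1 same uv by (simp add: insert_commute)
      ultimately show ?thesis using Y by blast
    next
      case 2
      then have "\<phi> u \<noteq> u" using same uv by simp
      then have "u \<notin> \<phi> ` Y" using center_idem by blast
      moreover have "e = {u, \<phi> u}" using 2 uv by simp
      ultimately show ?thesis using Y by blast
    next
      case 3
      have "{u, v} \<in> edges_in E {u, v}" using Y by (simp add: edges_in_def)
      then have "0 < card (edges_in E {u, v})" by (auto simp: card_gt_0_iff)
      then have "dense E (insert (\<phi> u) {u, v})"
        using 3 same uv Y center_adj[of u] center_adj[of v]
        by (intro dense_insert[where x = u and y = v]) (auto simp: insert_commute)
      moreover have "insert (\<phi> u) {u, v} \<subseteq> Y" using Y center_in by auto
      moreover have "card (insert (\<phi> u) {u, v}) \<le> 6" by (simp add: card_insert_if)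
      ultimately show ?thesis using short[of "insert (\<phi> u) {u, v}"] by simp
    qed
  qed
  then have "card (edges_in E Y - cross) \<le> card (Y - \<phi> ` Y)"
    using finite by (meson finite_Diff finite_imageI surj_card_le)
  moreover have "card (edges_in E Y) = card cross + card (edges_in E Y - cross)"
    using cross_subset finite by (metis card_Diff_subset card_mono finite_cross finite_edges_in le_add_diff_inverse)
  ultimately show ?thesis using card_cross by linarith
qed

end

text \<open>Without isolated vertices, a maximal independent set and its complement both dominate;
  the smaller of the two serves as the set of centres.\<close>

lemma ex_star_contraction:
  assumes E: "two_uniform E" and Y: "finite Y"
    and iso: "\<And>v. v \<in> Y \<Longrightarrow> \<exists>w\<in>Y. {v, w} \<in> E"
  obtains \<phi> where "star_contraction E Y \<phi>" "2 * card (\<phi> ` Y) \<le> card Y"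
proof -
  let ?P = "\<lambda>I. I \<subseteq> Y \<and> edges_in E I = {}"
  have "?P {}" using edges_in_empty[OF E] by simp
  moreover have "\<forall>I. ?P I \<longrightarrow> card I < Suc (card Y)" using Y by (simp add: card_mono less_Suc_eq_le)
  ultimately obtain I where I: "?P I" and max: "\<And>J. ?P J \<Longrightarrow> card J \<le> card I"
    using ex_has_greatest_nat[of ?P "{}" card "Suc (card Y)"] by blast
  have finI: "finite I" using I Y by (auto intro: finite_subset)
  have dom1: "\<exists>w\<in>I. {v, w} \<in> E" if "v \<in> Y - I" for v
  proof (rule ccontr)
    assume no: "\<not> ?thesis"
    have "edges_in E (insert v I) = {}"
    proof (rule ccontr)
      assume "\<not> ?thesis"
      then obtain e where e: "e \<in> E" "e \<subseteq> insert v I" by (auto simp: edges_in_def)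
      then have "v \<in> e" using I by (auto simp: edges_in_def)
      then obtain w where "w \<noteq> v" "e = {v, w}" using two_uniformD[OF E e(1)] by blast
      with e no show False by auto
    qed
    then have "card (insert v I) \<le> card I" using max that I by simp
    then show False using that finI by simp
  qed
  have dom2: "\<exists>w\<in>Y - I. {v, w} \<in> E" if v: "v \<in> I" for v
  proof -
    obtain w where w: "w \<in> Y" "{v, w} \<in> E" using iso v I by blast
    have "w \<notin> I"
    proof
      assume "w \<in> I"
      then have "{v, w} \<in> edges_in E I" using v w by (simp add: edges_in_def)
      with I show False by simp
    qed
    with w show ?thesis by blast
  qed
  have "card Y = card I + card (Y - I)"
    using I Y finI by (metis card_Diff_subset card_mono le_add_diff_inverse)
  moreover have "\<forall>v\<in>Y - (Y - I). \<exists>w\<in>Y - I. {v, w} \<in> E" using dom2 by blast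
  ultimately obtain D where D: "D \<subseteq> Y" "2 * card D \<le> card Y" "\<forall>v\<in>Y - D. \<exists>w\<in>D. {v, w} \<in> E"
    using dom1 I by (cases "card I \<le> card (Y - I)") (auto intro: that[of I] that[of "Y - I"])
  then obtain g where g: "\<And>v. v \<in> Y - D \<Longrightarrow> g v \<in> D \<and> {v, g v} \<in> E" by metis
  let ?\<phi> = "\<lambda>v. if v \<in> D then v else g v"
  have "star_contraction E Y ?\<phi>"
    by unfold_locales (use E Y g D in auto)
  moreover have "?\<phi> ` Y \<subseteq> D" using g by auto
  then have "card (?\<phi> ` Y) \<le> card D" using D Y by (meson card_mono finite_subset)
  ultimately show thesis using that D(2) by (meson le_trans mult_le_mono2)
qed

subsection \<open>Short cycles\<close>

text \<open>Contracting stars at least halves the number of vertices and preserves the excess of edges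
  over vertices, so it improves an edge density of \<open>a / 2\<close> to \<open>a - 1\<close>, while dividing the
  girth by at most three.\<close>

lemma short_dense_set:
  assumes "3 \<le> a"
  shows "\<exists>L. \<forall>(E :: 'a set set) V. two_uniform E \<longrightarrow> finite V \<longrightarrow> V \<noteq> {} \<longrightarrow>
    a * card V \<le> 2 * card (edges_in E V) \<longrightarrow> \<not> packing E n V \<longrightarrow>
    (\<exists>Z\<subseteq>V. dense E Z \<and> card Z \<le> L)"
  using assms
proof (induction "6 * n - a" arbitrary: a rule: less_induct)
  case less
  show ?case
  proof (cases "6 * n \<le> a")
    \<comment> \<open>Density \<open>a / 2\<close> is now at least \<open>3 * n\<close>, enough for
      \<open>packing_if_many_edges\<close>.\<close>
    case True
    have "packing E n V" if "two_uniform E" "finite V" "V \<noteq> {}"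
      "a * card V \<le> 2 * card (edges_in E V)" for E :: "'a set set" and V
    proof (rule packing_if_many_edges)
      have "6 * n * card V \<le> a * card V" using True by simp
      with that(4) show "3 * n * card V \<le> card (edges_in E V)" by linarith
    qed (use that in auto)
    then show ?thesis by blast
  next
    case False
    \<comment> \<open>The density after contraction is \<open>a' / 2 = a - 1\<close>. Since
      \<open>a\<close> is at least three, \<open>a'\<close> exceeds \<open>a\<close> and the measure
      decreases.\<close>
    define a' where "a' = 2 * a - 2"
    have "6 * n - a' < 6 * n - a" "3 \<le> a'" using False less.prems by (auto simp: a'_def)
    from less.hyps[OF this] obtain L where L: "\<And>(E :: 'a set set) V. two_uniform E \<Longrightarrow> finite V \<Longrightarrow> V \<noteq> {} \<Longrightarrow>
      a' * card V \<le> 2 * card (edges_in E V) \<Longrightarrow> \<not> packing E n V \<Longrightarrow>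
      \<exists>Z\<subseteq>V. dense E Z \<and> card Z \<le> L" by metis
    \<comment> \<open>The summand six covers the dense sets that obstruct the contraction, and
      \<open>3 * L\<close> those lifted from the contracted graph.\<close>
    have "\<exists>Z\<subseteq>V. dense E Z \<and> card Z \<le> 6 + 3 * L"
      if E: "two_uniform E" and V: "finite V" "V \<noteq> {}" "a * card V \<le> 2 * card (edges_in E V)"
        "\<not> packing E n V" for E :: "'a set set" and V
    proof (rule ccontr)
      assume no: "\<not> ?thesis"
      \<comment> \<open>A smallest subset of this density has no isolated vertex, as removing one
        would keep the edges. This makes \<open>ex_star_contraction\<close> applicable.\<close>
      let ?P = "\<lambda>Y. Y \<subseteq> V \<and> Y \<noteq> {} \<and> a * card Y \<le> 2 * card (edges_in E Y)"
      have "?P V" using V by simp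
      from ex_has_least_nat[of ?P, OF this, of card] obtain Y
        where Y: "?P Y" and min: "\<And>Z. ?P Z \<Longrightarrow> card Y \<le> card Z" by blast
      have finY: "finite Y" using Y V by (auto intro: finite_subset)
      have iso: "\<exists>w\<in>Y. {v, w} \<in> E" if v: "v \<in> Y" for v
      proof (rule ccontr)
        assume "\<not> ?thesis"
        then have "{w \<in> Y. {v, w} \<in> E} = {}" by blast
        then have "card (edges_at E Y v) = 0" by (simp only: card_edges_at[OF E v] card.empty)
        then have eq: "card (edges_in E Y) = card (edges_in E (Y - {v}))"
          using card_edges_in_remove[OF finY, of E v] by simp
        have lt: "card (Y - {v}) < card Y" using finY v by (intro psubset_card_mono) auto
        then have "a * card (Y - {v}) \<le> a * card Y" by simp
        then have "a * card (Y - {v}) \<le> 2 * card (edges_in E (Y - {v}))" using Y eq by linarith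
        moreover have "Y - {v} \<noteq> {}"
        proof
          assume "Y - {v} = {}"
          then have "edges_in E (Y - {v}) = {}" using edges_in_empty[OF E] by (simp only:)
          then have "card (edges_in E Y) = 0" using eq by simp
          then have "a * card Y = 0" using Y by linarith
          with Y finY less.prems show False by simp
        qed
        moreover have "Y - {v} \<subseteq> V" using Y by blast
        ultimately have "card Y \<le> card (Y - {v})" by (intro min conjI)
        with lt show False by simp
      qed
      obtain \<phi> where \<phi>: "star_contraction E Y \<phi>" "2 * card (\<phi> ` Y) \<le> card Y"
        using ex_star_contraction[OF E finY iso] by blast
      interpret star_contraction E Y \<phi> by (fact \<phi>)
      have img: "\<phi> ` Y \<subseteq> Y" using center_in by blast
      have "card Y = card (\<phi> ` Y) + card (Y - \<phi> ` Y)"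
        using img finY by (metis card_Diff_subset card_mono finite_imageI le_add_diff_inverse)
      moreover have "6 < card Z" if "Z \<subseteq> Y" "dense E Z" for Z
      proof (rule ccontr)
        assume "\<not> 6 < card Z"
        then have "card Z \<le> 6 + 3 * L" by simp
        moreover have "Z \<subseteq> V" using that(1) Y by blast
        ultimately show False using no that(2) by blast
      qed
      note card_edges_le_contracted[OF this]
      ultimately have ge: "card (edges_in E Y) + card (\<phi> ` Y)
          \<le> card (edges_in contracted (\<phi> ` Y)) + card Y" by linarith
      \<comment> \<open>The contraction has at least \<open>b * card Y\<close> plus twice the number
        of centres as its doubled edge count. As \<open>Y\<close> has at least two vertices per
        centre, this amounts to at least \<open>2 * b + 2 = a'\<close> per centre.\<close>
      define b where "b = a - 2"
      then have b: "a = b + 2" using less.prems by simp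
      have "b * (2 * card (\<phi> ` Y)) \<le> b * card Y" using \<phi>(2) by (rule mult_le_mono2)
      moreover have "a * card Y = b * card Y + 2 * card Y" by (simp add: b algebra_simps)
      moreover have "a' * card (\<phi> ` Y) = b * (2 * card (\<phi> ` Y)) + 2 * card (\<phi> ` Y)"
        by (simp add: a'_def b algebra_simps)
      ultimately have "a' * card (\<phi> ` Y) \<le> 2 * card (edges_in contracted (\<phi> ` Y))"
        using ge Y by linarith
      moreover have "\<not> packing contracted n (\<phi> ` Y)"
      proof
        assume "packing contracted n (\<phi> ` Y)"
        then have "packing E n {v \<in> Y. \<phi> v \<in> \<phi> ` Y}" by (rule packing_lift) simp
        then have "packing E n V" by (rule packing_mono) (use Y in auto)
        with V show False by simp
      qed
      ultimately obtain W where W: "W \<subseteq> \<phi> ` Y" "dense contracted W" "card W \<le> L"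
        using L[OF two_uniform_contracted, of "\<phi> ` Y"] finY Y by auto
      obtain Z where Z: "dense E Z" "Z \<subseteq> {v \<in> Y. \<phi> v \<in> W}" "card Z \<le> 3 * card W"
        using dense_lift[OF W(2,1)] .
      then have "Z \<subseteq> V" "card Z \<le> 6 + 3 * L" using W Y by auto
      then show False using no Z(1) by blast
    qed
    then show ?thesis by blast
  qed
qed


subsection \<open>The Erdos--Posa theorem\<close>

lemma edges_at_mono: "Y \<subseteq> Y' \<Longrightarrow> edges_at E Y v \<subseteq> edges_at E Y' v"
  by (auto simp: edges_at_def edges_in_def)

lemma cyclic_mono_edges:
  assumes "cyclic E X" "E \<subseteq> E'"
  shows "cyclic E' X"
proof -
  obtain Y where Y: "Y \<subseteq> X" "dense E Y" using assms(1) by (auto simp: cyclic_def)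
  then have "card (edges_in E Y) \<le> card (edges_in E' Y)"
    using edges_in_mono[OF assms(2) subset_refl[of Y]] by (intro card_mono) (auto simp: dense_def)
  then have "dense E' Y" using Y by (auto simp: dense_def)
  then show ?thesis using Y(1) by (auto simp: cyclic_def)
qed

text \<open>A vertex of degree at most one lies on no cycle.\<close>

lemma cyclic_remove:
  assumes E: "two_uniform E" and X: "finite X" "cyclic E X" and deg: "card (edges_at E X v) \<le> 1"
  shows "cyclic E (X - {v})"
proof -
  obtain Y where Y: "Y \<subseteq> X" "dense E Y" using X by (auto simp: cyclic_def)
  show ?thesis
  proof (cases "v \<in> Y")
    case True
    have "card (edges_at E Y v) \<le> card (edges_at E X v)"
      using X Y by (intro card_mono edges_at_mono) auto
    then have "dense E (Y - {v})" using dense_remove[OF E Y(2) _ True] deg by simp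
    moreover have "Y - {v} \<subseteq> X - {v}" using Y by blast
    ultimately show ?thesis by (auto simp: cyclic_def)
  next
    case False
    then have "Y \<subseteq> X - {v}" using Y by blast
    then show ?thesis using Y(2) by (auto simp: cyclic_def)
  qed
qed

text \<open>A dense set that relies on the added edge contains both its ends and is at most one edge
  short in \<open>E\<close>. Inserting \<open>v\<close> with its edges to \<open>x\<close> and
  \<open>y\<close> repairs this.\<close>

lemma cyclic_subdivide:
  assumes C: "cyclic (insert {x, y} E) C" "\<not> cyclic E C" "v \<notin> C"
    and "x \<noteq> y" "{v, x} \<in> E" "{v, y} \<in> E"
  shows "cyclic E (insert v C)" "{x, y} \<subseteq> C"
proof -
  obtain Y where Y: "Y \<subseteq> C" "dense (insert {x, y} E) Y" using C(1) by (auto simp: cyclic_def)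
  then have not: "\<not> dense E Y" "finite Y" using C(2) by (auto simp: cyclic_def dense_def)
  have xy: "{x, y} \<subseteq> Y"
  proof (rule ccontr)
    assume "\<not> ?thesis"
    then have "edges_in (insert {x, y} E) Y = edges_in E Y" by (auto simp: edges_in_def)
    with Y not show False by (simp add: dense_def)
  qed
  then show "{x, y} \<subseteq> C" using Y by blast
  have "edges_in (insert {x, y} E) Y \<subseteq> insert {x, y} (edges_in E Y)" by (auto simp: edges_in_def)
  then have "card (edges_in (insert {x, y} E) Y) \<le> card (insert {x, y} (edges_in E Y))"
    using not by (intro card_mono) auto
  also have "\<dots> \<le> Suc (card (edges_in E Y))" using not by (simp add: card_insert_if)
  finally have "card Y \<le> Suc (card (edges_in E Y))" using Y by (simp add: dense_def)
  then have "dense E (insert v Y)"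
    using assms not xy Y by (intro dense_insert[where x = x and y = y]) auto
  then have "cyclic E (insert v Y)" by (rule dense_cyclic)
  then show "cyclic E (insert v C)" by (rule cyclic_mono) (use Y in blast)
qed

text \<open>The added edge can matter for at most one of the disjoint sets. Up to that set
  \<open>v\<close> is held in reserve; after it, the ends of the edge are gone.\<close>

lemma packing_subdivide:
  assumes "x \<noteq> y" "{v, x} \<in> E" "{v, y} \<in> E"
  shows "packing (insert {x, y} E) n X \<Longrightarrow> v \<notin> X \<Longrightarrow> packing E n (insert v X)"
proof (induction n arbitrary: X)
  case (Suc n)
  then obtain C where C: "C \<subseteq> X" "cyclic (insert {x, y} E) C"
    "packing (insert {x, y} E) n (X - C)" by auto
  then have v: "v \<notin> C" using Suc.prems(2) by blast
  show ?case
  proof (cases "cyclic E C")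
    case True
    have "packing E n (insert v (X - C))" using Suc.IH C(3) Suc.prems(2) by blast
    from packing_SucI[OF True _ this] show ?thesis using C v by blast
  next
    case False
    note sub = cyclic_subdivide[OF C(2) False v assms]
    have "packing E n (X - C) \<longleftrightarrow> packing (insert {x, y} E) n (X - C)"
      by (rule packing_cong) (use sub(2) in auto)
    with C(3) have "packing E n (X - C)" by simp
    from packing_SucI[OF sub(1) _ this] show ?thesis using C Suc.prems(2) by blast
  qed
qed simp

text \<open>If both neighbours are present, removing \<open>v\<close> costs one vertex and two
  edges. The added edge restores the balance because it was not in \<open>E\<close> before.\<close>

lemma cyclic_suppress:
  assumes E: "two_uniform E" and X: "finite X" "cyclic E X"
    and nb: "{w \<in> X. {v, w} \<in> E} \<subseteq> {x, y}" and xy: "x \<noteq> y" "{x, y} \<notin> E"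
  shows "cyclic (insert {x, y} E) (X - {v})"
proof -
  let ?E = "insert {x, y} E"
  obtain Y where Y: "Y \<subseteq> X" "dense E Y" using X by (auto simp: cyclic_def)
  then have finY: "finite Y" by (simp add: dense_def)
  consider "v \<notin> Y" | "v \<in> Y" "card (edges_at E Y v) \<le> 1" | "v \<in> Y" "2 \<le> card (edges_at E Y v)"
    by linarith
  then show ?thesis
  proof cases
    case 1
    then have "Y \<subseteq> X - {v}" using Y by blast
    then have "cyclic E (X - {v})" using Y(2) by (auto simp: cyclic_def)
    then show ?thesis by (rule cyclic_mono_edges) auto
  next
    case 2
    have "cyclic E (Y - {v})" by (rule cyclic_remove[OF E finY dense_cyclic[OF Y(2)] 2(2)])
    then have "cyclic E (X - {v})" by (rule cyclic_mono) (use Y in auto)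
    then show ?thesis by (rule cyclic_mono_edges) auto
  next
    case 3
    let ?N = "{w \<in> Y. {v, w} \<in> E}"
    have N: "?N \<subseteq> {x, y}" using nb Y by blast
    have card_N: "card ?N = card (edges_at E Y v)" using card_edges_at[OF E 3(1)] by simp
    have "card ?N \<le> card {x, y}" using N by (intro card_mono) auto
    then have "card ?N = 2" using 3 card_N xy by simp
    then have "?N = {x, y}" using N xy by (intro card_subset_eq) auto
    then have mem: "x \<in> Y" "y \<in> Y" "{v, x} \<in> E" "{v, y} \<in> E" by blast+
    then have "x \<noteq> v" "y \<noteq> v" using two_uniform_ne[OF E] by blast+
    then have sub: "insert {x, y} (edges_in E (Y - {v})) \<subseteq> edges_in ?E (Y - {v})"
      using mem by (auto simp: edges_in_def)
    have "Suc (card (edges_in E (Y - {v}))) = card (insert {x, y} (edges_in E (Y - {v})))"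
      using xy finY by (simp add: edges_in_def)
    also have "\<dots> \<le> card (edges_in ?E (Y - {v}))" using sub finY by (intro card_mono) auto
    finally have ge: "Suc (card (edges_in E (Y - {v}))) \<le> card (edges_in ?E (Y - {v}))" .
    have "card Y \<le> card (edges_in E (Y - {v})) + 2"
      using card_edges_in_remove[OF finY, of E v] Y(2) card_N \<open>card ?N = 2\<close> by (simp add: dense_def)
    moreover have "card (Y - {v}) = card Y - 1" using 3 finY by simp
    ultimately have "card (Y - {v}) \<le> card (edges_in ?E (Y - {v}))" using ge by linarith
    moreover have "Y - {v} \<noteq> {}" using mem \<open>x \<noteq> v\<close> by blast
    ultimately have "dense ?E (Y - {v})" using finY by (simp add: dense_def)
    then have "cyclic ?E (Y - {v})" by (rule dense_cyclic)
    then show ?thesis by (rule cyclic_mono) (use Y in auto)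
  qed
qed

text \<open>By the degree sum, minimum degree three yields the starting density \<open>a = 3\<close>
  of \<open>short_dense_set\<close>.\<close>

lemma min_degree_or_low:
  assumes "two_uniform E" "finite V"
  obtains "3 * card V \<le> 2 * card (edges_in E V)" | v where "v \<in> V" "card (edges_at E V v) \<le> 2"
proof (cases "\<exists>v\<in>V. card (edges_at E V v) \<le> 2")
  case False
  then have "(\<Sum>v\<in>V. 3) \<le> (\<Sum>v\<in>V. card (edges_at E V v))" by (intro sum_mono) auto
  then show thesis using that(1) sum_card_edges_at[OF assms] by simp
qed (use that(2) in blast)

text \<open>Induction on \<open>k\<close>. Either a dense set of bounded size is removed, after
  which the bound for the preceding value applies, or a vertex of degree at most two is deleted or
  suppressed with the bound unchanged.\<close>

theorem erdos_posa:
  "\<exists>m. \<forall>(E :: 'a set set) V. two_uniform E \<longrightarrow> finite V \<longrightarrow> \<not> packing E (Suc k) V \<longrightarrow>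
    (\<exists>B\<subseteq>V. card B \<le> m \<and> \<not> cyclic E (V - B))"
proof (induction k)
  case 0
  have "\<exists>B\<subseteq>V. card B \<le> 0 \<and> \<not> cyclic E (V - B)" if "\<not> packing E (Suc 0) V"
    for E :: "'a set set" and V
  proof -
    have "\<not> cyclic E V" using that packing_SucI[of E V V 0 "{}"] by simp
    then show ?thesis by (intro exI[of _ "{}"]) simp
  qed
  then show ?case by blast
next
  case (Suc k)
  then obtain m where m: "\<And>(E :: 'a set set) V. two_uniform E \<Longrightarrow> finite V \<Longrightarrow>
      \<not> packing E (Suc k) V \<Longrightarrow> \<exists>B\<subseteq>V. card B \<le> m \<and> \<not> cyclic E (V - B)" by metis
  obtain L where L: "\<And>(E :: 'a set set) V. two_uniform E \<Longrightarrow> finite V \<Longrightarrow> V \<noteq> {} \<Longrightarrow>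
      3 * card V \<le> 2 * card (edges_in E V) \<Longrightarrow> \<not> packing E (Suc (Suc k)) V \<Longrightarrow>
      \<exists>Z\<subseteq>V. dense E Z \<and> card Z \<le> L"
    using short_dense_set[of 3 "Suc (Suc k)"] by (metis order_refl)
  \<comment> \<open>\<open>L\<close> bounds the dense set found at minimum degree three, and
    \<open>3\<close> is the size of a triangle at a vertex of degree two.\<close>
  let ?m = "m + (3 + L)"
  have short: "\<exists>B\<subseteq>V. card B \<le> ?m \<and> \<not> cyclic E (V - B)"
    if E: "two_uniform E" and fin: "finite V" and np: "\<not> packing E (Suc (Suc k)) V"
      and Z: "Z \<subseteq> V" "dense E Z" "card Z \<le> 3 + L" for E :: "'a set set" and V Z
  proof -
    have "\<not> packing E (Suc k) (V - Z)"
      using np packing_SucI[OF dense_cyclic[OF Z(2)] Z(1), of "Suc k" "V - Z"] by blast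
    then obtain B where B: "B \<subseteq> V - Z" "card B \<le> m" "\<not> cyclic E (V - Z - B)"
      using m[OF E, of "V - Z"] fin by auto
    have "card (B \<union> Z) \<le> ?m" using card_Un_le[of B Z] B(2) Z(3) by linarith
    moreover have "V - (B \<union> Z) = V - Z - B" by blast
    then have "\<not> cyclic E (V - (B \<union> Z))" using B(3) by simp
    moreover have "B \<union> Z \<subseteq> V" using B(1) Z(1) by blast
    ultimately show ?thesis by blast
  qed
  have "\<exists>B\<subseteq>V. card B \<le> ?m \<and> \<not> cyclic E (V - B)"
    if "two_uniform E" "finite V" "\<not> packing E (Suc (Suc k)) V" for E :: "'a set set" and V
    using that
  proof (induction "card V" arbitrary: E V rule: less_induct)
    case less
    note E = less.prems(1) and fin = less.prems(2) and np = less.prems(3)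
    consider "V = {}" | "V \<noteq> {}" "3 * card V \<le> 2 * card (edges_in E V)"
      | v where "v \<in> V" "card (edges_at E V v) \<le> 1"
      | v where "v \<in> V" "card (edges_at E V v) = 2"
    proof (rule min_degree_or_low[OF E fin])
      fix v assume v: "v \<in> V" "card (edges_at E V v) \<le> 2"
      then consider "card (edges_at E V v) \<le> 1" | "card (edges_at E V v) = 2" by linarith
      then show ?thesis using that(3,4) v(1) by cases
    qed (use that(1,2) in blast)
    then show ?case
    proof cases
      case 1
      then have "\<not> cyclic E V" by (auto simp: cyclic_def dense_def)
      then show ?thesis by (intro exI[of _ "{}"]) simp
    next
      case 2
      then obtain Z where Z: "Z \<subseteq> V" "dense E Z" "card Z \<le> L" using L[OF E fin] np by blast
      then have "card Z \<le> 3 + L" by simp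
      then show ?thesis using short[OF E fin np Z(1,2)] by blast
    next
      case (3 v)
      have lt: "card (V - {v}) < card V" using 3 fin by (intro psubset_card_mono) auto
      have "\<not> packing E (Suc (Suc k)) (V - {v})" using np packing_mono[of E _ "V - {v}" V] by blast
      then obtain B where B: "B \<subseteq> V - {v}" "card B \<le> ?m" "\<not> cyclic E (V - {v} - B)"
        using less.hyps[OF lt E] fin by auto
      have "\<not> cyclic E (V - B)"
      proof
        assume c: "cyclic E (V - B)"
        have "card (edges_at E (V - B) v) \<le> card (edges_at E V v)"
          using fin by (intro card_mono edges_at_mono) auto
        then have "cyclic E (V - B - {v})" using cyclic_remove[OF E _ c] fin 3 by simp
        moreover have "V - B - {v} = V - {v} - B" by blast
        ultimately show False using B(3) by simp
      qed
      then show ?thesis using B by blast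
    next
      case (4 v)
      have "card {w \<in> V. {v, w} \<in> E} = 2" using 4 card_edges_at[OF E 4(1)] by simp
      then obtain x y where xy: "{w \<in> V. {v, w} \<in> E} = {x, y}" "x \<noteq> y"
        by (auto simp: card_2_iff)
      then have mem: "x \<in> V" "y \<in> V" "{v, x} \<in> E" "{v, y} \<in> E" by blast+
      then have ne: "v \<noteq> x" "v \<noteq> y" using two_uniform_ne[OF E] by blast+
      show ?thesis
      proof (cases "{x, y} \<in> E")
        \<comment> \<open>Suppression would create a parallel edge; instead \<open>v\<close> and its
          neighbours form a triangle, which is dense.\<close>
        case True
        then have "{x, y} \<in> edges_in E {x, y}" by (simp add: edges_in_def)
        then have "0 < card (edges_in E {x, y})" by (auto simp: card_gt_0_iff)
        then have "dense E (insert v {x, y})"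
          using ne mem xy(2) by (intro dense_insert[where x = x and y = y]) auto
        moreover have "insert v {x, y} \<subseteq> V" using mem 4 by blast
        moreover have "card (insert v {x, y}) \<le> 3 + L" by (simp add: card_insert_if)
        ultimately show ?thesis using short[OF E fin np, of "insert v {x, y}"] by blast
      next
        case False
        let ?E = "insert {x, y} E"
        have lt: "card (V - {v}) < card V" using 4 fin by (intro psubset_card_mono) auto
        have "two_uniform ?E" using E xy(2) by (simp add: two_uniform_def)
        moreover have "\<not> packing ?E (Suc (Suc k)) (V - {v})"
        proof
          assume "packing ?E (Suc (Suc k)) (V - {v})"
          then have "packing E (Suc (Suc k)) (insert v (V - {v}))"
            by (rule packing_subdivide[OF xy(2) mem(3,4)]) simp
          then show False using np 4(1) by (simp only: insert_Diff)
        qed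
        ultimately obtain B where B: "B \<subseteq> V - {v}" "card B \<le> ?m" "\<not> cyclic ?E (V - {v} - B)"
          using less.hyps[OF lt, of ?E] fin by auto
        have "\<not> cyclic E (V - B)"
        proof
          assume c: "cyclic E (V - B)"
          have "{w \<in> V - B. {v, w} \<in> E} \<subseteq> {x, y}" using xy(1) by blast
          then have "cyclic ?E (V - B - {v})" using cyclic_suppress[OF E _ c] fin xy(2) False by simp
          moreover have "V - B - {v} = V - {v} - B" by blast
          ultimately show False using B(3) by simp
        qed
        then show ?thesis using B by blast
      qed
    qed
  qed
  then show ?case by blast
qed


subsection \<open>Hitting cycles through a forest\<close>

text \<open>In an acyclic graph, a tight set is one that induces a tree.\<close>

definition tight :: "'a set set \<Rightarrow> 'a set \<Rightarrow> bool" where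
  "tight E P \<longleftrightarrow> finite P \<and> P \<noteq> {} \<and> card P \<le> Suc (card (edges_in E P))"

text \<open>Since \<open>F\<close> is acyclic, a cycle in \<open>insert u F\<close> passes through
  \<open>u\<close>. Rotated to begin at \<open>u\<close>, it leaves a path, and paths are tight by
  \<open>path_card_edges\<close>.\<close>

lemma ex_tight:
  assumes E: "two_uniform E" and F: "\<not> cyclic E F" "cyclic E (insert u F)"
  obtains P where "P \<subseteq> F" "tight E P" "cyclic E (insert u P)"
proof -
  obtain c where c: "list_cycle E c" "set c \<subseteq> insert u F" using cyclic_list_cycle[OF E F(2)] by blast
  have "u \<in> set c"
  proof (rule ccontr)
    assume "u \<notin> set c"
    then have "set c \<subseteq> F" using c(2) by blast
    then show False using F(1) cyclic_mono[OF dense_cyclic[OF list_cycle_dense[OF c(1)]]] by blast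
  qed
  then obtain m where m: "m < length c" "c ! m = u" by (auto simp: in_set_conv_nth)
  then have "c \<noteq> []" by auto
  then have "hd (rotate m c) = u" "rotate m c \<noteq> []" using m by (simp_all add: hd_rotate_conv_nth)
  then obtain p where p: "rotate m c = u # p" by (cases "rotate m c") auto
  have cyc: "list_cycle E (u # p)" using list_cycle_rotate[OF c(1), of m] p by simp
  note D = list_cycle_ConsD[OF cyc]
  show thesis
  proof (rule that)
    have "set (u # p) = set c" using p by (metis set_rotate)
    then show "set p \<subseteq> F" using c(2) D(2) by auto
    show "tight E (set p)"
      using path_card_edges[OF D(1,7)] D(1,7) by (simp add: tight_def path_def distinct_card)
    show "cyclic E (insert u (set p))" using dense_cyclic[OF list_cycle_dense[OF cyc]] by simp
  qed
qed

lemma tight_insert: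
  assumes "tight E P" "w \<notin> P" "x \<in> P" "{w, x} \<in> E"
  shows "tight E (insert w P)"
proof -
  have fin: "finite P" using assms by (simp add: tight_def)
  have "{w, x} \<notin> edges_in E P" using assms by (auto simp: edges_in_def)
  then have "Suc (card (edges_in E P)) = card (insert {w, x} (edges_in E P))" using fin by simp
  also have "\<dots> \<le> card (edges_in E (insert w P))"
    using assms fin by (intro card_mono) (auto simp: edges_in_def)
  finally show ?thesis using assms fin by (simp add: tight_def)
qed

text \<open>A second neighbour in a tree would close a cycle within \<open>F\<close>.\<close>

lemma tight_neighbour_unique:
  assumes "tight E P" "\<not> cyclic E F" "insert w P \<subseteq> F" "w \<notin> P"
    and "x \<in> P" "y \<in> P" "{w, x} \<in> E" "{w, y} \<in> E"
  shows "x = y"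
proof (rule ccontr)
  assume "x \<noteq> y"
  then have "dense E (insert w P)"
    using assms by (intro dense_insert[where x = x and y = y]) (auto simp: tight_def)
  then show False using assms(2,3) cyclic_mono[OF dense_cyclic] by blast
qed

text \<open>A tight set cannot be spread over two parts with no edge between them: each part would
  have fewer edges than vertices, so the union would be at least two edges short.\<close>

lemma cyclic_insert_Un:
  assumes E: "two_uniform E" and F: "\<not> cyclic E (F1 \<union> F2)" "cyclic E (insert u (F1 \<union> F2))"
    and sep: "\<And>e. e \<in> E \<Longrightarrow> e \<subseteq> F1 \<union> F2 \<Longrightarrow> e \<subseteq> F1 \<or> e \<subseteq> F2" and disj: "F1 \<inter> F2 = {}"
  shows "cyclic E (insert u F1) \<or> cyclic E (insert u F2)"
proof -
  obtain P where P: "P \<subseteq> F1 \<union> F2" "tight E P" "cyclic E (insert u P)"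
    using ex_tight[OF E F] .
  have fin: "finite P" using P(2) by (simp add: tight_def)
  have "P \<subseteq> F1 \<or> P \<subseteq> F2"
  proof (rule ccontr)
    assume "\<not> ?thesis"
    then have ne: "P \<inter> F1 \<noteq> {}" "P \<inter> F2 \<noteq> {}" using P(1) by blast+
    have "card (edges_in E (P \<inter> F1)) < card (P \<inter> F1)" "card (edges_in E (P \<inter> F2)) < card (P \<inter> F2)"
      using not_cyclic_card[OF F(1)] P(1) fin ne by auto
    moreover have "edges_in E P \<subseteq> edges_in E (P \<inter> F1) \<union> edges_in E (P \<inter> F2)"
      using sep P(1) unfolding edges_in_def by blast
    then have "card (edges_in E P) \<le> card (edges_in E (P \<inter> F1) \<union> edges_in E (P \<inter> F2))"
      using fin by (intro card_mono) auto
    moreover have "\<dots> \<le> card (edges_in E (P \<inter> F1)) + card (edges_in E (P \<inter> F2))"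
      by (rule card_Un_le)
    moreover have "P = (P \<inter> F1) \<union> (P \<inter> F2)" using P(1) by blast
    then have "card P = card (P \<inter> F1) + card (P \<inter> F2)"
      using fin disj by (metis card_Un_disjoint finite_Int inf_commute inf_left_commute inf_bot_right)
    ultimately show False using P(2) by (simp add: tight_def)
  qed
  then show ?thesis using P(3) cyclic_mono[of E "insert u P"] by blast
qed

text \<open>A set \<open>T\<close> is a branch with root \<open>t\<close> if the edges of the forest \<open>F\<close> leaving \<open>T\<close> all
  contain \<open>t\<close>. This replaces the subtrees of a rooted forest.\<close>

definition branch :: "'a set set \<Rightarrow> 'a set \<Rightarrow> 'a \<Rightarrow> 'a set \<Rightarrow> bool" where
  "branch E F t T \<longleftrightarrow> T \<subseteq> F \<and> t \<in> T \<and>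
     (\<forall>e\<in>E. e \<subseteq> F \<longrightarrow> e \<inter> T \<noteq> {} \<longrightarrow> e \<subseteq> T \<or> t \<in> e)"

text \<open>The new branch is a component of \<open>T - {t}\<close> that closes a cycle with
  \<open>u\<close>, obtained as a largest tight set containing \<open>P\<close>. Its edges to the
  outside lead to \<open>t\<close>, and by \<open>tight_neighbour_unique\<close> they share one end
  in \<open>K\<close>, the new root.\<close>

lemma ex_smaller_branch:
  assumes E: "two_uniform E" and F: "finite F" "\<not> cyclic E F" and T: "branch E F t T"
    and u: "cyclic E (insert u (T - {t}))"
  obtains s K where "branch E F s K" "K \<subseteq> T - {t}" "cyclic E (insert u K)"
proof -
  have sub: "T \<subseteq> F" "t \<in> T" using T by (auto simp: branch_def)
  have fin: "finite (T - {t})" using F(1) sub by (auto intro: finite_subset)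
  have "\<not> cyclic E (T - {t})" using F(2) sub(1) cyclic_mono[of E "T - {t}" F] by blast
  from ex_tight[OF E this u]
  obtain P where P: "P \<subseteq> T - {t}" "tight E P" "cyclic E (insert u P)" .
  let ?Q = "\<lambda>K. P \<subseteq> K \<and> K \<subseteq> T - {t} \<and> tight E K"
  have "?Q P" using P by simp
  moreover have "\<forall>K. ?Q K \<longrightarrow> card K < Suc (card (T - {t}))"
    using fin by (auto simp: less_Suc_eq_le intro: card_mono)
  ultimately obtain K where K: "?Q K" and max: "\<And>J. ?Q J \<Longrightarrow> card J \<le> card K"
    using ex_has_greatest_nat[of ?Q P card "Suc (card (T - {t}))"] by blast
  have finK: "finite K" "K \<noteq> {}" using K by (auto simp: tight_def)
  have closed: "b \<in> K" if ab: "a \<in> K" "b \<in> T - {t}" "{b, a} \<in> E" for a b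
  proof (rule ccontr)
    assume b: "b \<notin> K"
    have "tight E (insert b K)" using tight_insert[OF _ b ab(1,3)] K by blast
    moreover have "P \<subseteq> insert b K" "insert b K \<subseteq> T - {t}" using K ab(2) by blast+
    ultimately have "card (insert b K) \<le> card K" by (intro max conjI)
    then show False using b finK by simp
  qed
  obtain s where s: "s \<in> K" "\<And>a. a \<in> K \<Longrightarrow> {t, a} \<in> E \<Longrightarrow> a = s"
  proof (cases "\<exists>a\<in>K. {t, a} \<in> E")
    case True
    then obtain s where s: "s \<in> K" "{t, s} \<in> E" by blast
    have tK: "t \<notin> K" "insert t K \<subseteq> F" using K sub by blast+
    have "tight E K" using K by blast
    from tight_neighbour_unique[OF this F(2) tK(2,1) _ s(1) _ s(2)] that s(1) show thesis by blast
  next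
    \<comment> \<open>No edge of the forest leaves \<open>K\<close>, so any of its vertices can
      serve as root.\<close>
    case False
    then show thesis using that finK by blast
  qed
  show thesis
  proof (rule that)
    show "K \<subseteq> T - {t}" using K by blast
    show "cyclic E (insert u K)" using cyclic_mono[OF P(3), of "insert u K"] K by blast
    show "branch E F s K"
      unfolding branch_def
    proof (intro conjI ballI impI)
      show "K \<subseteq> F" using K sub by blast
      fix e assume e: "e \<in> E" "e \<subseteq> F" "e \<inter> K \<noteq> {}"
      then obtain a where a: "a \<in> e" "a \<in> K" by blast
      then obtain b where b: "b \<noteq> a" "e = {a, b}" using two_uniformD[OF E e(1)] by blast
      then have ba: "{b, a} \<in> E" using e(1) by (simp add: insert_commute)
      have aT: "a \<in> T - {t}" using a K by blast
      have "e \<subseteq> T \<or> t \<in> e" using T e a aT unfolding branch_def by blast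
      then have "b = t \<or> b \<in> T - {t}" using b aT by blast
      then show "e \<subseteq> K \<or> s \<in> e"
      proof
        assume "b = t"
        then show ?thesis using s(2)[OF a(2)] ba a by blast
      next
        assume "b \<in> T - {t}"
        then show ?thesis using closed[OF a(2) _ ba] a b by blast
      qed
    qed (fact s(1))
  qed
qed

text \<open>The whole forest is a branch for any choice of root, so a smallest branch closing a
  cycle exists. A cycle closed without its root would give a smaller one by
  \<open>ex_smaller_branch\<close>.\<close>

lemma ex_min_branch:
  assumes E: "two_uniform E" and F: "finite F" "\<not> cyclic E F" and v: "v \<in> B" "cyclic E (insert v F)"
  obtains t T w where "branch E F t T" "w \<in> B" "cyclic E (insert w T)"
    and "\<And>u. u \<in> B \<Longrightarrow> \<not> cyclic E (insert u (T - {t}))"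
proof -
  let ?Q = "\<lambda>T. \<exists>t w. branch E F t T \<and> w \<in> B \<and> cyclic E (insert w T)"
  have "F \<noteq> {}"
  proof
    assume "F = {}"
    then have "cyclic E {v}" using v(2) by simp
    then show False
      using dense_not_singleton[OF E] by (auto simp: cyclic_def subset_singleton_iff dense_def)
  qed
  then have "?Q F" using v by (auto simp: branch_def)
  from ex_has_least_nat[of ?Q, OF this, of card]
  obtain T where T: "?Q T" and min: "\<And>K. ?Q K \<Longrightarrow> card T \<le> card K" by blast
  then obtain t w where tw: "branch E F t T" "w \<in> B" "cyclic E (insert w T)" by blast
  then have sub: "T \<subseteq> F" "t \<in> T" by (auto simp: branch_def)
  then have fin: "finite T" using F(1) by (auto intro: finite_subset)
  show thesis
  proof (rule that[OF tw])
    fix u assume u: "u \<in> B"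
    show "\<not> cyclic E (insert u (T - {t}))"
    proof
      assume "cyclic E (insert u (T - {t}))"
      from ex_smaller_branch[OF E F tw(1) this]
      obtain s K where K: "branch E F s K" "K \<subseteq> T - {t}" "cyclic E (insert u K)" .
      have "card T \<le> card K" by (rule min) (use K u in blast)
      moreover have "card K < card T" using K(2) sub fin by (intro psubset_card_mono) auto
      ultimately show False by simp
    qed
  qed
qed

text \<open>A minimal branch closing a cycle with some \<open>v\<close> contributes \<open>v\<close> to \<open>X\<close>, its root to \<open>S\<close>, and
  a cycle to the packing.\<close>

lemma ex_hitting_set:
  assumes "two_uniform E" "finite F" "\<not> cyclic E F" "F \<inter> B = {}" "\<not> packing E (Suc k) (F \<union> B)"
  shows "\<exists>S\<subseteq>F. \<exists>X\<subseteq>B. finite X \<and> card S \<le> k \<and> card X \<le> k \<and>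
    (\<forall>u\<in>B - X. \<not> cyclic E (insert u (F - S)))"
  using assms
proof (induction k arbitrary: F B)
  case 0
  have "\<not> cyclic E (insert u F)" if u: "u \<in> B" for u
  proof
    assume c: "cyclic E (insert u F)"
    have "packing E (Suc 0) (F \<union> B)" by (rule packing_SucI[OF c, where Y = "{}"]) (use u in auto)
    then show False using 0 by blast
  qed
  then show ?case by (intro exI[of _ "{}"] conjI) auto
next
  case (Suc k)
  note E = Suc.prems(1) and F = Suc.prems(2,3) and disj = Suc.prems(4) and np = Suc.prems(5)
  show ?case
  proof (cases "\<exists>v\<in>B. cyclic E (insert v F)")
    case False
    then show ?thesis by (intro exI[of _ "{}"] conjI) auto
  next
    case True
    then obtain v0 where v0: "v0 \<in> B" "cyclic E (insert v0 F)" by blast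
    obtain t T v where T: "branch E F t T" "v \<in> B" "cyclic E (insert v T)"
      and min: "\<And>u. u \<in> B \<Longrightarrow> \<not> cyclic E (insert u (T - {t}))"
      using ex_min_branch[OF E F v0] by blast
    have sub: "T \<subseteq> F" "t \<in> T" using T by (auto simp: branch_def)
    let ?F = "F - T" and ?B = "B - {v}"
    have "\<not> packing E (Suc k) (?F \<union> ?B)"
    proof
      assume p: "packing E (Suc k) (?F \<union> ?B)"
      \<comment> \<open>The branch together with \<open>v\<close> is cyclic and disjoint from what
        remains, so it extends the packing by one.\<close>
      have "packing E (Suc (Suc k)) (F \<union> B)"
        by (rule packing_SucI[OF T(3) _ p]) (use sub T(2) disj in auto)
      then show False using np by blast
    qed
    moreover have "\<not> cyclic E ?F" using F(2) cyclic_mono[of E ?F F] by blast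
    moreover have "?F \<inter> ?B = {}" "finite ?F" using disj F by auto
    ultimately obtain S X where S: "S \<subseteq> ?F" "X \<subseteq> ?B" "finite X" "card S \<le> k" "card X \<le> k"
      and acyc: "\<And>u. u \<in> ?B - X \<Longrightarrow> \<not> cyclic E (insert u (?F - S))"
      using Suc.IH[OF E, of ?F ?B] by blast
    have "\<not> cyclic E (insert u (F - insert t S))" if u: "u \<in> B - insert v X" for u
    proof
      assume c: "cyclic E (insert u (F - insert t S))"
      \<comment> \<open>Without \<open>t\<close> no forest edge joins the branch to the rest, so a
        cycle through \<open>u\<close> would close within one side: minimality excludes the branch,
        the induction hypothesis the rest.\<close>
      let ?F1 = "T - {t}" and ?F2 = "?F - S"
      have c': "cyclic E (insert u (?F1 \<union> ?F2))" by (rule cyclic_mono[OF c]) blast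
      have "\<not> cyclic E (?F1 \<union> ?F2)"
      proof
        assume "cyclic E (?F1 \<union> ?F2)"
        then have "cyclic E F" by (rule cyclic_mono) (use sub in blast)
        then show False using F by blast
      qed
      moreover have "e \<subseteq> ?F1 \<or> e \<subseteq> ?F2" if e: "e \<in> E" "e \<subseteq> ?F1 \<union> ?F2" for e
      proof -
        have "e \<subseteq> F" "t \<notin> e" using e(2) sub by blast+
        then have "e \<inter> T = {} \<or> e \<subseteq> T" using T(1) e(1) unfolding branch_def by blast
        then show ?thesis using e(2) \<open>t \<notin> e\<close> by blast
      qed
      ultimately have "cyclic E (insert u ?F1) \<or> cyclic E (insert u ?F2)"
        by (intro cyclic_insert_Un[OF E _ c']) auto
      then show False using min[of u] acyc[of u] u by blast
    qed
    moreover have "finite S" using S(1) F(1) by (auto intro: finite_subset)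
    then have "card (insert t S) \<le> Suc k" "card (insert v X) \<le> Suc k"
      using S by (simp_all add: card_insert_if)
    moreover have "insert t S \<subseteq> F" "insert v X \<subseteq> B" "finite (insert v X)" using S sub T(2) by auto
    ultimately show ?thesis by meson
  qed
qed

subsection \<open>Graphs and their edge sets\<close>

lemma finite_simple_graph_two_uniform: "finite_simple_graph G \<Longrightarrow> two_uniform (ug_edges G)"
  by (auto simp: finite_simple_graph_def two_uniform_def)

lemma ug_cycle_iff: "ug_cycle G c \<longleftrightarrow> list_cycle (ug_edges G) c \<and> set c \<subseteq> ug_verts G"
  by (auto simp: ug_cycle_def list_cycle_def)

text \<open>Edges between vertices outside \<open>B\<close> survive the deletion, so only the vertex
  condition changes.\<close>

lemma ug_cycle_delete_verts_iff:
  "ug_cycle (delete_verts G B) c \<longleftrightarrow> list_cycle (ug_edges G) c \<and> set c \<subseteq> ug_verts G - B"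
proof
  assume "list_cycle (ug_edges G) c \<and> set c \<subseteq> ug_verts G - B"
  moreover have "c ! (Suc i mod length c) \<in> set c" if "i < length c" for i
    by (rule nth_mem) (use that in \<open>auto intro: mod_less_divisor\<close>)
  ultimately show "ug_cycle (delete_verts G B) c"
    by (auto simp: ug_cycle_iff list_cycle_def delete_verts_def dest: nth_mem)
qed (auto simp: ug_cycle_iff list_cycle_def delete_verts_def)

lemma blocker_iff:
  assumes "finite_simple_graph G"
  shows "blocker G B \<longleftrightarrow> B \<subseteq> ug_verts G \<and> \<not> cyclic (ug_edges G) (ug_verts G - B)"
proof -
  have "(\<exists>c. ug_cycle (delete_verts G B) c) \<longleftrightarrow> cyclic (ug_edges G) (ug_verts G - B)"
    unfolding ug_cycle_delete_verts_iff
    using cyclic_list_cycle[OF finite_simple_graph_two_uniform[OF assms]]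
      cyclic_mono[OF dense_cyclic[OF list_cycle_dense]] by metis
  then show ?thesis by (simp add: blocker_def)
qed

text \<open>Every cyclic set is shrunk to a cycle inside it; the set split off first receives the
  last index \<open>n\<close>.\<close>

lemma packing_iff_list_cycles:
  assumes E: "two_uniform E"
  shows "packing E n X \<longleftrightarrow> (\<exists>C :: nat \<Rightarrow> 'a list. (\<forall>i<n. list_cycle E (C i) \<and> set (C i) \<subseteq> X) \<and>
    (\<forall>i<n. \<forall>j<n. i \<noteq> j \<longrightarrow> set (C i) \<inter> set (C j) = {}))"
proof (induction n arbitrary: X)
  case (Suc n)
  show ?case
  proof
    assume "packing E (Suc n) X"
    then obtain D where D: "D \<subseteq> X" "cyclic E D" "packing E n (X - D)" by auto
    obtain c where c: "list_cycle E c" "set c \<subseteq> D" using cyclic_list_cycle[OF E D(2)] by blast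
    obtain C where C: "\<And>i. i < n \<Longrightarrow> list_cycle E (C i)" "\<And>i. i < n \<Longrightarrow> set (C i) \<subseteq> X - D"
      "\<And>i j. i < n \<Longrightarrow> j < n \<Longrightarrow> i \<noteq> j \<Longrightarrow> set (C i) \<inter> set (C j) = {}"
      using D(3) Suc.IH[of "X - D"] by blast
    let ?C = "\<lambda>i. if i < n then C i else c"
    have "set (C i) \<inter> set c = {}" "set c \<inter> set (C i) = {}" if "i < n" for i
      using C(2)[OF that] c(2) by blast+
    then have "set (?C i) \<inter> set (?C j) = {}" if "i < Suc n" "j < Suc n" "i \<noteq> j" for i j
      using that C(3)[of i j] by (auto simp only: less_Suc_eq split: if_split)
    moreover have "list_cycle E (?C i)" for i using C(1) c(1) by simp
    moreover have "set (?C i) \<subseteq> X" for i using C(2)[of i] c(2) D(1) by auto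
    ultimately have "(\<forall>i<Suc n. list_cycle E (?C i) \<and> set (?C i) \<subseteq> X) \<and>
        (\<forall>i<Suc n. \<forall>j<Suc n. i \<noteq> j \<longrightarrow> set (?C i) \<inter> set (?C j) = {})" by blast
    then show "\<exists>C. (\<forall>i<Suc n. list_cycle E (C i) \<and> set (C i) \<subseteq> X) \<and>
        (\<forall>i<Suc n. \<forall>j<Suc n. i \<noteq> j \<longrightarrow> set (C i) \<inter> set (C j) = {})" 
      by (rule exI[of _ ?C])
  next
    assume "\<exists>C. (\<forall>i<Suc n. list_cycle E (C i) \<and> set (C i) \<subseteq> X) \<and>
        (\<forall>i<Suc n. \<forall>j<Suc n. i \<noteq> j \<longrightarrow> set (C i) \<inter> set (C j) = {})"
    then obtain C where "(\<forall>i<Suc n. list_cycle E (C i) \<and> set (C i) \<subseteq> X) \<and>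
        (\<forall>i<Suc n. \<forall>j<Suc n. i \<noteq> j \<longrightarrow> set (C i) \<inter> set (C j) = {})" by (rule exE)
    then have C: "\<And>i. i < Suc n \<Longrightarrow> list_cycle E (C i)"
      "\<And>i. i < Suc n \<Longrightarrow> set (C i) \<subseteq> X"
      "\<And>i j. i < Suc n \<Longrightarrow> j < Suc n \<Longrightarrow> i \<noteq> j \<Longrightarrow> set (C i) \<inter> set (C j) = {}" by simp_all
    have "set (C i) \<subseteq> X - set (C n)" if "i < n" for i
      using C(2)[of i] C(3)[of i n] that by auto
    then have "packing E n (X - set (C n))"
      unfolding Suc.IH using C(1,3) by (intro exI[of _ C]) simp
    moreover have "cyclic E (set (C n))" using C(1)[of n] dense_cyclic list_cycle_dense by blast
    moreover have "set (C n) \<subseteq> X" using C(2)[of n] by simp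
    ultimately show "packing E (Suc n) X" by (intro packing_SucI) auto
  qed
qed simp

lemma has_disjoint_cycles_iff:
  assumes "finite_simple_graph G"
  shows "has_disjoint_cycles n G \<longleftrightarrow> packing (ug_edges G) n (ug_verts G)"
  unfolding has_disjoint_cycles_def ug_cycle_iff
    packing_iff_list_cycles[OF finite_simple_graph_two_uniform[OF assms]] ..

section \<open>Transport along injections and the value \<open>f(k)\<close>\<close>

lemma cyclic_image:
  assumes "cyclic E X" "inj_on g X"
  shows "cyclic ((`) g ` E) (g ` X)"
proof -
  obtain Y where Y: "Y \<subseteq> X" "dense E Y" using assms(1) by (auto simp: cyclic_def)
  then have fin: "finite Y" by (simp add: dense_def)
  have inj: "inj_on g Y" using assms(2) Y(1) by (rule inj_on_subset)
  have "inj_on ((`) g) (edges_in E Y)"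
    using inj_on_image_Pow[OF inj] by (rule inj_on_subset) (auto simp: edges_in_def)
  then have "card (edges_in E Y) = card ((`) g ` edges_in E Y)" by (simp add: card_image)
  \<comment> \<open>Injectivity is given on \<open>X\<close> only, so further edges may land in the
    image; density requires just this inequality.\<close>
  also have "\<dots> \<le> card (edges_in ((`) g ` E) (g ` Y))"
    using fin by (intro card_mono) (auto simp: edges_in_def)
  finally have "dense ((`) g ` E) (g ` Y)" using Y(2) inj by (auto simp: dense_def card_image)
  then show ?thesis using cyclic_mono[OF dense_cyclic image_mono[OF Y(1)]] by blast
qed

lemma packing_image:
  "packing E n X \<Longrightarrow> inj_on g X \<Longrightarrow> packing ((`) g ` E) n (g ` X)"
proof (induction n arbitrary: X)
  case (Suc n)
  then obtain C where C: "C \<subseteq> X" "cyclic E C" "packing E n (X - C)" by auto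
  have "inj_on g C" "inj_on g (X - C)" using Suc.prems(2) C(1) by (auto intro: inj_on_subset)
  then have "cyclic ((`) g ` E) (g ` C)" "packing ((`) g ` E) n (g ` (X - C))"
    using cyclic_image C(2) Suc.IH C(3) by auto
  moreover have "g ` (X - C) \<subseteq> g ` X - g ` C"
    using inj_on_image_set_diff[OF Suc.prems(2), of X C] C(1) by auto
  moreover have "g ` C \<subseteq> g ` X" using C(1) by blast
  ultimately show ?case by (intro packing_SucI)
qed simp

lemma ex_erdos_posa_bound: "\<exists>m>0. erdos_posa_bound k m"
proof -
  obtain m where m: "\<And>(E :: nat set set) V. two_uniform E \<Longrightarrow> finite V \<Longrightarrow>
      \<not> packing E (Suc k) V \<Longrightarrow> \<exists>B\<subseteq>V. card B \<le> m \<and> \<not> cyclic E (V - B)"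
    using erdos_posa by metis
  \<comment> \<open>The successor makes the bound positive, as the definition of
    \<open>erdos_posa_f\<close> demands.\<close>
  have "erdos_posa_bound k (Suc m)"
    unfolding erdos_posa_bound_def
  proof (intro allI impI)
    fix G :: "nat ugraph"
    assume G: "finite_simple_graph G" "\<not> has_disjoint_cycles (k + 1) G"
    then have "finite (ug_verts G)" "\<not> packing (ug_edges G) (Suc k) (ug_verts G)"
      by (simp_all add: finite_simple_graph_def has_disjoint_cycles_iff)
    then obtain B where "B \<subseteq> ug_verts G" "card B \<le> m" "\<not> cyclic (ug_edges G) (ug_verts G - B)"
      using m[OF finite_simple_graph_two_uniform[OF G(1)]] by blast
    then show "\<exists>B. blocker G B \<and> card B \<le> Suc m"
      unfolding blocker_iff[OF G(1)] by (intro exI[of _ B]) simp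
  qed
  then show ?thesis by blast
qed

lemma erdos_posa_bound_f: "erdos_posa_bound k (erdos_posa_f k)"
  unfolding erdos_posa_f_def
  using LeastI_ex[OF ex_erdos_posa_bound[of k]] by blast

text \<open>As \<open>erdos_posa_f\<close> speaks of graphs on natural numbers, \<open>G\<close> is
  copied there by an injection \<open>g\<close> and the blocker is pulled back along its
  inverse.\<close>

lemma ex_blocker_card_le_f:
  fixes G :: "'a ugraph"
  assumes G: "finite_simple_graph G" and no: "\<not> has_disjoint_cycles (k + 1) G"
  shows "\<exists>B. blocker G B \<and> card B \<le> erdos_posa_f k"
proof -
  let ?V = "ug_verts G" and ?E = "ug_edges G"
  have fin: "finite ?V" and edges: "\<And>e. e \<in> ?E \<Longrightarrow> e \<subseteq> ?V \<and> card e = 2"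
    using G by (auto simp: finite_simple_graph_def)
  obtain g :: "'a \<Rightarrow> nat" where g: "inj_on g ?V" using finite_imp_inj_to_nat_seg[OF fin] by blast
  let ?h = "inv_into ?V g"
  let ?G = "(g ` ?V, (`) g ` ?E) :: nat ugraph"
  have "card (g ` e) = 2" if "e \<in> ?E" for e
    using edges[OF that] card_image[OF inj_on_subset[OF g]] by metis
  then have G': "finite_simple_graph ?G"
    using fin edges by (auto simp: finite_simple_graph_def)
  have hg: "?h ` g ` e = e" if "e \<subseteq> ?V" for e using g that by (rule inv_into_image_cancel)
  have "(`) ?h ` (`) g ` ?E = ?E" using hg edges by (force simp: image_image)
  moreover have "?h ` g ` ?V = ?V" using hg by blast
  moreover have inj_h: "inj_on ?h (g ` ?V)" by (rule inj_on_inv_into) simp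
  ultimately have "packing (ug_edges ?G) (k + 1) (ug_verts ?G) \<Longrightarrow> packing ?E (k + 1) ?V"
    using packing_image[of "(`) g ` ?E" "k + 1" "g ` ?V" ?h] by simp
  then have "\<not> has_disjoint_cycles (k + 1) ?G"
    using no unfolding has_disjoint_cycles_iff[OF G] has_disjoint_cycles_iff[OF G'] by blast
  then obtain B where B: "blocker ?G B" "card B \<le> erdos_posa_f k"
    using erdos_posa_bound_f[of k] G' unfolding erdos_posa_bound_def by blast
  then have sub: "B \<subseteq> g ` ?V" and acyc: "\<not> cyclic ((`) g ` ?E) (g ` ?V - B)"
    unfolding blocker_iff[OF G'] by simp_all
  let ?B = "?h ` B"
  have subB: "?B \<subseteq> ?V" using sub by (auto intro: inv_into_into)
  have gB: "g ` ?B = B" by (rule image_inv_into_cancel[OF refl sub])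
  have "g ` (?V - ?B) = g ` ?V - B" using inj_on_image_set_diff[OF g _ subB, of ?V] gB by simp
  then have "\<not> cyclic ?E (?V - ?B)"
    using acyc cyclic_image[of ?E "?V - ?B" g] inj_on_subset[OF g, of "?V - ?B"] by auto
  moreover have "card ?B \<le> card B" using finite_subset[OF sub] fin by (intro card_image_le) simp
  ultimately show ?thesis using B(2) subB unfolding blocker_iff[OF G] by (intro exI[of _ ?B]) simp
qed

section \<open>From a blocker of size at most \<open>f(k)\<close> to a redundant one\<close>

theorem theorem1p3:
  fixes k :: nat and G :: "'a ugraph"
  assumes "0 < k"
    and "finite_simple_graph G"
    and "\<not> has_disjoint_cycles (k + 1) G"
  shows "\<exists>B. redundant_blocker k G B \<and> card B \<le> erdos_posa_f k + k"
proof -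
  let ?V = "ug_verts G" and ?E = "ug_edges G"
  have E: "two_uniform ?E" and fin: "finite ?V"
    using assms(2) by (auto simp: finite_simple_graph_two_uniform finite_simple_graph_def)
  obtain B where B: "B \<subseteq> ?V" "\<not> cyclic ?E (?V - B)" "card B \<le> erdos_posa_f k"
    using ex_blocker_card_le_f[OF assms(2,3)] unfolding blocker_iff[OF assms(2)] by blast
  have "\<not> packing ?E (Suc k) ((?V - B) \<union> B)"
    using assms(3) B(1) unfolding has_disjoint_cycles_iff[OF assms(2)] by (simp add: Un_absorb2)
  then obtain S X where S: "S \<subseteq> ?V - B" "X \<subseteq> B" "finite X" "card S \<le> k" "card X \<le> k"
    and acyc: "\<And>u. u \<in> B - X \<Longrightarrow> \<not> cyclic ?E (insert u (?V - B - S))"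
    using ex_hitting_set[OF E _ B(2), of B k] fin by blast
  let ?B = "B \<union> S"
  have sub: "?B \<subseteq> ?V" using B(1) S(1) by blast
  have blocker_mono: "blocker G (B \<union> D)" if "D \<subseteq> ?V" for D
    unfolding blocker_iff[OF assms(2)] using that B cyclic_mono[of ?E "?V - (B \<union> D)" "?V - B"] by blast
  \<comment> \<open>A vertex of \<open>B\<close> outside \<open>X\<close> can return to the graph,
    since it closes no cycle with the forest minus \<open>S\<close>. A vertex of \<open>S\<close>
    can return because \<open>B\<close> alone is a blocker.\<close>
  have "{v \<in> ?B. \<not> blocker G (?B - {v})} \<subseteq> X"
  proof
    fix v assume v: "v \<in> {v \<in> ?B. \<not> blocker G (?B - {v})}"
    show "v \<in> X"
    proof (rule ccontr)
      assume vX: "v \<notin> X"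
      show False
      proof (cases "v \<in> B")
        case True
        then have "?V - (?B - {v}) = insert v (?V - B - S)" using B(1) S(1) by blast
        then have "blocker G (?B - {v})"
          unfolding blocker_iff[OF assms(2)] using acyc[of v] True vX sub by auto
        then show False using v by blast
      next
        case False
        then have "?B - {v} = B \<union> (S - {v})" by blast
        then have "blocker G (?B - {v})" using blocker_mono[of "S - {v}"] S(1) by auto
        then show False using v by blast
      qed
    qed
  qed
  from card_mono[OF S(3) this] S(5)
  have "card {v \<in> ?B. \<not> blocker G (?B - {v})} \<le> k" by (rule le_trans)
  moreover have "blocker G ?B" using blocker_mono S(1) by blast
  moreover have "card ?B \<le> erdos_posa_f k + k" using card_Un_le[of B S] B(3) S(4) by linarith
  ultimately show ?thesis unfolding redundant_blocker_def by blast
qed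

end
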